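(* Let $\Gamma$ be a simplicial graph, $\mathcal{G}=\{G_u \mid u\in V(\Gamma)\}$ a collection of groups indexed by $V(\Gamma)$, and $a,b\in\Gamma\mathcal{G}$ two graphically cyclically reduced elements. Then $a$ and $b$ are conjugate in $\Gamma\mathcal{G}$ if and only if there exist graphically reduced words $x_1\cdots x_rp_1\cdots p_n$ and $y_1\cdots y_rq_1\cdots q_n$ (with $r,n\geq 0$) such that \begin{itemize} \item $a=x_1\cdots x_rp_1\cdots p_n$ and $b=y_1\cdots y_rq_1\cdots q_n$ in $\Gamma\mathcal{G}$; \item the $p_i$'s and the $q_i$'s are floating syllables of $x_1\cdots x_rp_1\cdots p_n$ and $y_1\cdots y_rq_1\cdots q_n$ respectively, and, for every $1\leq i\leq n$, $p_i$ and $q_i$ belong to a common vertex-group and are conjugate in it; \item the word $y_1\cdots y_r$ can be obtained from the word $x_1\cdots x_r$ by a finite sequence of operations, each of which permutes two consecutive syllables belonging to adjacent vertex-groups or performs a cyclic permutation. \end{itemize}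
   Context: The graph product $\Gamma\mathcal{G}$ is the quotient of the free product $\ast_{u\in V(\Gamma)}G_u$ by the normal subgroup generated by all commutators $[g,h]$ with $g\in G_u$, $h\in G_v$, $\{u,v\}\in E(\Gamma)$. The $G_u$ are called vertex-groups and are always assumed non-trivial. Two vertex-groups $G_u,G_v$ are adjacent if $\{u,v\}\in E(\Gamma)$. Let $w=s_1\cdots s_n$ be a word of length $n\geq 1$ written over $\bigcup_{u\in V(\Gamma)}G_u$; the $s_i$ are its syllables. The word $w$ is graphically reduced if: (i) either $n=1$ and $s_1=1$, or $s_i\neq 1$ for every $i$; and (ii) for every $1\leq i<j\leq n$, either $s_i$ and $s_j$ do not belong to the same vertex-group, or there exists some $i<k<j$ such that $s_k$ does not belong to a vertex-group adjacent to the common vertex-group containing $s_i$ and $s_j$. The word $w$ is graphically cyclically reduced if it is graphically reduced and there do not exist $1\leq i<j\leq n$ such that $s_i$ and $s_j$ belong to a common vertex-group, this vertex-group being adjacent to the vertex-group containing $s_k$ for every $1\leq k<i$ and for every $j<k\leq n$. An element of $\Gamma\mathcal{G}$ is graphically cyclically reduced if all the graphically reduced words representing it are graphically cyclically reduced. A syllable $s_i$ of a word $s_1\cdots s_n$ is floating if the vertex-group containing $s_i$ is adjacent to the vertex-group containing $s_k$ for every $k\neq i$. *)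

theory Defs
  imports "HOL-Algebra.Coset"
begin

section \<open>Free products\<close>

text \<open>
  The vertex-groups form a family \<open>G v\<close>, \<open>v \<in> V\<close>, of groups with elements in one common type. A
  syllable is a pair \<open>(v, g)\<close> with \<open>g \<in> carrier (G v)\<close>; the tag \<open>v\<close> makes the union of the
  vertex-groups disjoint and names the vertex-group a syllable belongs to.
\<close>

definition syllables :: "'v set \<Rightarrow> ('v \<Rightarrow> ('g, 'm) monoid_scheme) \<Rightarrow> ('v \<times> 'g) set" where
  "syllables V G = (SIGMA v:V. carrier (G v))"

text \<open>
  The free product is the monoid of words modulo the congruence generated by deleting trivial
  syllables and multiplying two consecutive syllables of the same vertex-group.
\<close>

inductive word_eq :: "'v set \<Rightarrow> ('v \<Rightarrow> ('g, 'm) monoid_scheme) \<Rightarrow>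
    ('v \<times> 'g) list \<Rightarrow> ('v \<times> 'g) list \<Rightarrow> bool" for V G where
  delete: "xs \<in> lists (syllables V G) \<Longrightarrow> ys \<in> lists (syllables V G) \<Longrightarrow> v \<in> V \<Longrightarrow>
    word_eq V G (xs @ [(v, \<one>\<^bsub>G v\<^esub>)] @ ys) (xs @ ys)"
| merge: "xs \<in> lists (syllables V G) \<Longrightarrow> ys \<in> lists (syllables V G) \<Longrightarrow> v \<in> V \<Longrightarrow>
    g \<in> carrier (G v) \<Longrightarrow> h \<in> carrier (G v) \<Longrightarrow>
    word_eq V G (xs @ [(v, g), (v, h)] @ ys) (xs @ [(v, g \<otimes>\<^bsub>G v\<^esub> h)] @ ys)"
| refl: "xs \<in> lists (syllables V G) \<Longrightarrow> word_eq V G xs xs"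
| sym: "word_eq V G xs ys \<Longrightarrow> word_eq V G ys xs"
| trans: "word_eq V G xs ys \<Longrightarrow> word_eq V G ys zs \<Longrightarrow> word_eq V G xs zs"

definition word_class :: "'v set \<Rightarrow> ('v \<Rightarrow> ('g, 'm) monoid_scheme) \<Rightarrow>
    ('v \<times> 'g) list \<Rightarrow> ('v \<times> 'g) list set" where
  "word_class V G xs = {ys. word_eq V G xs ys}"

definition free_product :: "'v set \<Rightarrow> ('v \<Rightarrow> ('g, 'm) monoid_scheme) \<Rightarrow>
    ('v \<times> 'g) list set monoid" where
  "free_product V G =
    \<lparr>carrier = word_class V G ` lists (syllables V G),
     mult = (\<lambda>A B. \<Union>xs\<in>A. \<Union>ys\<in>B. word_class V G (xs @ ys)),
     one = word_class V G []\<rparr>"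

section \<open>Graph products\<close>

text \<open>An edge is a two-element set of vertices, so there are neither loops nor multiple edges.\<close>

definition simplicial_graph :: "'v set \<Rightarrow> 'v set set \<Rightarrow> bool" where
  "simplicial_graph V E \<longleftrightarrow> (\<forall>e\<in>E. e \<subseteq> V \<and> card e = 2)"

definition normal_closure :: "('a, 'm) monoid_scheme \<Rightarrow> 'a set \<Rightarrow> 'a set" where
  "normal_closure H S = \<Inter>{N. N \<lhd> H \<and> S \<subseteq> N}"

definition commutator :: "('a, 'm) monoid_scheme \<Rightarrow> 'a \<Rightarrow> 'a \<Rightarrow> 'a" where
  "commutator H x y = x \<otimes>\<^bsub>H\<^esub> y \<otimes>\<^bsub>H\<^esub> inv\<^bsub>H\<^esub> x \<otimes>\<^bsub>H\<^esub> inv\<^bsub>H\<^esub> y"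

definition conjugate_in :: "('a, 'm) monoid_scheme \<Rightarrow> 'a \<Rightarrow> 'a \<Rightarrow> bool" where
  "conjugate_in H x y \<longleftrightarrow> (\<exists>h\<in>carrier H. y = h \<otimes>\<^bsub>H\<^esub> x \<otimes>\<^bsub>H\<^esub> inv\<^bsub>H\<^esub> h)"

definition edge_commutators :: "'v set \<Rightarrow> 'v set set \<Rightarrow> ('v \<Rightarrow> ('g, 'm) monoid_scheme) \<Rightarrow>
    ('v \<times> 'g) list set set" where
  "edge_commutators V E G =
    {commutator (free_product V G) (word_class V G [(u, g)]) (word_class V G [(v, h)]) | u v g h.
      u \<in> V \<and> v \<in> V \<and> {u, v} \<in> E \<and> g \<in> carrier (G u) \<and> h \<in> carrier (G v)}"

definition graph_relators :: "'v set \<Rightarrow> 'v set set \<Rightarrow> ('v \<Rightarrow> ('g, 'm) monoid_scheme) \<Rightarrow>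
    ('v \<times> 'g) list set set" where
  "graph_relators V E G = normal_closure (free_product V G) (edge_commutators V E G)"

definition graph_product :: "'v set \<Rightarrow> 'v set set \<Rightarrow> ('v \<Rightarrow> ('g, 'm) monoid_scheme) \<Rightarrow>
    ('v \<times> 'g) list set set monoid" where
  "graph_product V E G = free_product V G Mod graph_relators V E G"

definition syllable_elem :: "'v set \<Rightarrow> 'v set set \<Rightarrow> ('v \<Rightarrow> ('g, 'm) monoid_scheme) \<Rightarrow>
    'v \<times> 'g \<Rightarrow> ('v \<times> 'g) list set set" where
  "syllable_elem V E G s = graph_relators V E G #>\<^bsub>free_product V G\<^esub> word_class V G [s]"

text \<open>The element of the graph product represented by a word.\<close>

definition word_elem :: "'v set \<Rightarrow> 'v set set \<Rightarrow> ('v \<Rightarrow> ('g, 'm) monoid_scheme) \<Rightarrow>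
    ('v \<times> 'g) list \<Rightarrow> ('v \<times> 'g) list set set" where
  "word_elem V E G w =
    foldr (\<lambda>s x. syllable_elem V E G s \<otimes>\<^bsub>graph_product V E G\<^esub> x) w \<one>\<^bsub>graph_product V E G\<^esub>"

section \<open>Reduced words and floating syllables\<close>

text \<open>
  Words are indexed from \<open>0\<close>. A graphically reduced word has at least one syllable; the identity
  of the graph product is represented by the one-syllable words \<open>[(v, \<one>\<^bsub>G v\<^esub>)]\<close>.
\<close>

definition graphically_reduced :: "'v set \<Rightarrow> 'v set set \<Rightarrow> ('v \<Rightarrow> ('g, 'm) monoid_scheme) \<Rightarrow>
    ('v \<times> 'g) list \<Rightarrow> bool" where
  "graphically_reduced V E G w \<longleftrightarrow>
    w \<in> lists (syllables V G) \<and> length w \<ge> 1 \<and>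
    (length w = 1 \<and> snd (w ! 0) = \<one>\<^bsub>G (fst (w ! 0))\<^esub> \<or>
     (\<forall>i<length w. snd (w ! i) \<noteq> \<one>\<^bsub>G (fst (w ! i))\<^esub>)) \<and>
    (\<forall>i j. i < j \<and> j < length w \<longrightarrow>
      fst (w ! i) \<noteq> fst (w ! j) \<or>
      (\<exists>k. i < k \<and> k < j \<and> {fst (w ! k), fst (w ! i)} \<notin> E))"

definition graphically_cyclically_reduced_word :: "'v set \<Rightarrow> 'v set set \<Rightarrow>
    ('v \<Rightarrow> ('g, 'm) monoid_scheme) \<Rightarrow> ('v \<times> 'g) list \<Rightarrow> bool" where
  "graphically_cyclically_reduced_word V E G w \<longleftrightarrow>
    graphically_reduced V E G w \<and>
    \<not> (\<exists>i j. i < j \<and> j < length w \<and> fst (w ! i) = fst (w ! j) \<and>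
        (\<forall>k<length w. k < i \<or> j < k \<longrightarrow> {fst (w ! i), fst (w ! k)} \<in> E))"

definition graphically_cyclically_reduced :: "'v set \<Rightarrow> 'v set set \<Rightarrow>
    ('v \<Rightarrow> ('g, 'm) monoid_scheme) \<Rightarrow> ('v \<times> 'g) list set set \<Rightarrow> bool" where
  "graphically_cyclically_reduced V E G a \<longleftrightarrow>
    a \<in> carrier (graph_product V E G) \<and>
    (\<forall>w. graphically_reduced V E G w \<and> word_elem V E G w = a \<longrightarrow>
      graphically_cyclically_reduced_word V E G w)"

definition floating :: "'v set set \<Rightarrow> ('v \<times> 'g) list \<Rightarrow> nat \<Rightarrow> bool" where
  "floating E w i \<longleftrightarrow>
    i < length w \<and> (\<forall>k<length w. k \<noteq> i \<longrightarrow> {fst (w ! i), fst (w ! k)} \<in> E)"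

inductive word_move :: "'v set set \<Rightarrow> ('v \<times> 'g) list \<Rightarrow> ('v \<times> 'g) list \<Rightarrow> bool" for E where
  swap: "{fst s, fst t} \<in> E \<Longrightarrow> word_move E (xs @ [s, t] @ ys) (xs @ [t, s] @ ys)"
| rotate: "word_move E (xs @ ys) (ys @ xs)"

section \<open>The group structure\<close>

lemma word_eq_lists:
  assumes "word_eq V G xs ys" and "\<And>v. v \<in> V \<Longrightarrow> group (G v)"
  shows "xs \<in> lists (syllables V G) \<and> ys \<in> lists (syllables V G)"
  using assms(1)
proof induction
  case (delete xs ys v)
  then show ?case
    using group.is_monoid[OF assms(2)] by (auto simp: syllables_def monoid.one_closed)
next
  case (merge xs ys v g h)
  then show ?case
    using group.is_monoid[OF assms(2)] by (auto simp: syllables_def monoid.m_closed)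
qed auto

lemma word_eq_append1:
  assumes "word_eq V G xs ys" "zs \<in> lists (syllables V G)"
  shows "word_eq V G (xs @ zs) (ys @ zs)"
  using assms(1)
proof induction
  case (delete xs ys v)
  then show ?case using word_eq.delete[of xs V G "ys @ zs" v] assms(2) by simp
next
  case (merge xs ys v g h)
  then show ?case using word_eq.merge[of xs V G "ys @ zs" v g h] assms(2) by simp
next
  case (refl xs)
  then show ?case using assms(2) by (intro word_eq.refl) simp
next
  case (sym xs ys)
  show ?case using sym.IH by (rule word_eq.sym)
next
  case (trans xs ys us)
  show ?case using trans.IH by (rule word_eq.trans)
qed

lemma word_eq_append2:
  assumes "word_eq V G xs ys" "zs \<in> lists (syllables V G)"
  shows "word_eq V G (zs @ xs) (zs @ ys)"
  using assms(1)
proof induction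
  case (delete xs ys v)
  then show ?case using word_eq.delete[of "zs @ xs" V G ys v] assms(2) by simp
next
  case (merge xs ys v g h)
  then show ?case using word_eq.merge[of "zs @ xs" V G ys v g h] assms(2) by simp
next
  case (refl xs)
  then show ?case using assms(2) by (intro word_eq.refl) simp
next
  case (sym xs ys)
  show ?case using sym.IH by (rule word_eq.sym)
next
  case (trans xs ys us)
  show ?case using trans.IH by (rule word_eq.trans)
qed

lemma word_class_eq_iff:
  assumes "xs \<in> lists (syllables V G)"
  shows "word_class V G xs = word_class V G ys \<longleftrightarrow> word_eq V G xs ys"
proof
  assume eq: "word_class V G xs = word_class V G ys"
  have "xs \<in> word_class V G xs"
    using word_eq.refl[OF assms] unfolding word_class_def by (rule CollectI)
  then have "word_eq V G ys xs"
    unfolding eq unfolding word_class_def by (rule CollectD)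
  then show "word_eq V G xs ys" by (rule word_eq.sym)
next
  assume eq: "word_eq V G xs ys"
  have "word_eq V G xs zs \<longleftrightarrow> word_eq V G ys zs" for zs
    using word_eq.trans[OF eq, of zs] word_eq.trans[OF word_eq.sym[OF eq], of zs] by (rule iffI[rotated])
  then show "word_class V G xs = word_class V G ys"
    unfolding word_class_def by (rule Collect_cong)
qed

lemma free_product_mult:
  assumes "\<And>v. v \<in> V \<Longrightarrow> group (G v)"
    and "xs \<in> lists (syllables V G)" "ys \<in> lists (syllables V G)"
  shows "word_class V G xs \<otimes>\<^bsub>free_product V G\<^esub> word_class V G ys = word_class V G (xs @ ys)"
proof -
  have cong: "word_class V G (xs' @ ys') = word_class V G (xs @ ys)"
    if "word_eq V G xs xs'" "word_eq V G ys ys'" for xs' ys'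
  proof -
    have "xs' \<in> lists (syllables V G)" "ys' \<in> lists (syllables V G)"
      using word_eq_lists[OF that(1)] word_eq_lists[OF that(2)] assms(1) by auto
    then have "word_eq V G (xs @ ys) (xs' @ ys')"
      using word_eq_append1[OF that(1) assms(3)] word_eq_append2[OF that(2), of xs']
      by (auto intro: word_eq.trans[of _ _ _ "xs' @ ys"])
    then show ?thesis
      using word_class_eq_iff[of "xs @ ys" V G "xs' @ ys'"] assms by simp
  qed
  have mem: "xs \<in> word_class V G xs" "ys \<in> word_class V G ys"
    using assms word_eq.refl by (auto simp: word_class_def)
  have "(\<Union>xs'\<in>word_class V G xs. \<Union>ys'\<in>word_class V G ys. word_class V G (xs' @ ys')) =
      word_class V G (xs @ ys)"
  proof (intro equalityI subsetI)
    fix zs assume "zs \<in> word_class V G (xs @ ys)"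
    with mem show "zs \<in> (\<Union>xs'\<in>word_class V G xs. \<Union>ys'\<in>word_class V G ys. word_class V G (xs' @ ys'))"
      by blast
  next
    fix zs
    assume "zs \<in> (\<Union>xs'\<in>word_class V G xs. \<Union>ys'\<in>word_class V G ys. word_class V G (xs' @ ys'))"
    then obtain xs' ys' where "word_eq V G xs xs'" "word_eq V G ys ys'"
      and zs: "zs \<in> word_class V G (xs' @ ys')"
      unfolding word_class_def by blast
    from cong[OF this(1,2)] zs show "zs \<in> word_class V G (xs @ ys)" by (rule subst)
  qed
  then show ?thesis unfolding free_product_def monoid.simps partial_object.simps .
qed

lemma word_inverse:
  assumes grp: "\<And>v. v \<in> V \<Longrightarrow> group (G v)" and "xs \<in> lists (syllables V G)"
  shows "\<exists>ys\<in>lists (syllables V G). word_eq V G (ys @ xs) []"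
  using assms(2)
proof (induction xs)
  case Nil
  then show ?case by (auto intro: word_eq.refl)
next
  case (Cons s xs)
  obtain v g where s: "s = (v, g)" "v \<in> V" "g \<in> carrier (G v)"
    using Cons.hyps by (auto simp: syllables_def)
  interpret Gv: group "G v" using grp s(2) .
  from Cons obtain ys where ys: "ys \<in> lists (syllables V G)" "word_eq V G (ys @ xs) []" by auto
  have xs: "xs \<in> lists (syllables V G)" using Cons by simp
  have "word_eq V G (ys @ [(v, inv\<^bsub>G v\<^esub> g), (v, g)] @ xs) (ys @ [(v, \<one>\<^bsub>G v\<^esub>)] @ xs)"
    using word_eq.merge[OF ys(1) xs s(2), of "inv\<^bsub>G v\<^esub> g" g] s(3) by simp
  moreover have "word_eq V G (ys @ [(v, \<one>\<^bsub>G v\<^esub>)] @ xs) (ys @ xs)"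
    using word_eq.delete[OF ys(1) xs s(2)] .
  ultimately have "word_eq V G ((ys @ [(v, inv\<^bsub>G v\<^esub> g)]) @ s # xs) []"
    using word_eq.trans[OF word_eq.trans ys(2)] s(1) by simp
  moreover have "ys @ [(v, inv\<^bsub>G v\<^esub> g)] \<in> lists (syllables V G)"
    using ys(1) s by (auto simp: syllables_def)
  ultimately show ?case by blast
qed

lemma group_free_product:
  assumes grp: "\<And>v. v \<in> V \<Longrightarrow> group (G v)"
  shows "group (free_product V G)"
proof (rule groupI)
  have carr: "carrier (free_product V G) = word_class V G ` lists (syllables V G)"
    and one: "\<one>\<^bsub>free_product V G\<^esub> = word_class V G []"
    by (simp_all add: free_product_def)
  have mult: "word_class V G xs \<otimes>\<^bsub>free_product V G\<^esub> word_class V G ys = word_class V G (xs @ ys)"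
    if "xs \<in> lists (syllables V G)" "ys \<in> lists (syllables V G)" for xs ys
    using grp that by (rule free_product_mult)
  show "\<one>\<^bsub>free_product V G\<^esub> \<in> carrier (free_product V G)"
    unfolding carr one by blast
  fix x assume "x \<in> carrier (free_product V G)"
  then obtain xs where x: "x = word_class V G xs" "xs \<in> lists (syllables V G)"
    unfolding carr by blast
  show "\<one>\<^bsub>free_product V G\<^esub> \<otimes>\<^bsub>free_product V G\<^esub> x = x"
    unfolding one x(1) using mult[OF lists.Nil x(2)] by simp
  obtain ys where ys: "ys \<in> lists (syllables V G)" "word_eq V G (ys @ xs) []"
    using word_inverse[OF grp x(2)] by blast
  then have "word_class V G ys \<otimes>\<^bsub>free_product V G\<^esub> x = \<one>\<^bsub>free_product V G\<^esub>"
    unfolding one x(1) mult[OF ys(1) x(2)] using x(2) word_class_eq_iff[of "ys @ xs" V G "[]"] by simp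
  then show "\<exists>y\<in>carrier (free_product V G). y \<otimes>\<^bsub>free_product V G\<^esub> x = \<one>\<^bsub>free_product V G\<^esub>"
    unfolding carr using ys by blast
  fix y assume "y \<in> carrier (free_product V G)"
  then obtain ys where y: "y = word_class V G ys" "ys \<in> lists (syllables V G)"
    unfolding carr by blast
  have xy: "x \<otimes>\<^bsub>free_product V G\<^esub> y = word_class V G (xs @ ys)"
    unfolding x(1) y(1) using mult[OF x(2) y(2)] .
  show "x \<otimes>\<^bsub>free_product V G\<^esub> y \<in> carrier (free_product V G)"
    unfolding xy carr using x(2) y(2) by simp
  fix z assume "z \<in> carrier (free_product V G)"
  then obtain zs where z: "z = word_class V G zs" "zs \<in> lists (syllables V G)"
    unfolding carr by blast
  have app: "xs @ ys \<in> lists (syllables V G)" "ys @ zs \<in> lists (syllables V G)"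
    using x(2) y(2) z(2) by simp_all
  show "x \<otimes>\<^bsub>free_product V G\<^esub> y \<otimes>\<^bsub>free_product V G\<^esub> z =
      x \<otimes>\<^bsub>free_product V G\<^esub> (y \<otimes>\<^bsub>free_product V G\<^esub> z)"
    unfolding x(1) y(1) z(1) mult[OF x(2) y(2)] mult[OF y(2) z(2)] mult[OF app(1) z(2)]
      mult[OF x(2) app(2)] append_assoc ..
qed

lemma normal_normal_closure:
  assumes "group H" "S \<subseteq> carrier H"
  shows "normal_closure H S \<lhd> H"
proof -
  interpret H: group H by fact
  have top: "carrier H \<lhd> H"
    by (rule H.normal_invI) (auto intro: H.subgroup_self)
  have "subgroup (normal_closure H S) H"
    unfolding normal_closure_def
    using top assms(2) by (intro H.subgroups_Inter) (auto simp: normal_def)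
  then show ?thesis
    by (rule H.normal_invI)
      (auto simp: normal_closure_def intro: normal.inv_op_closed2)
qed

lemma group_graph_product:
  assumes grp: "\<And>v. v \<in> V \<Longrightarrow> group (G v)"
  shows "group (graph_product V E G)"
proof -
  interpret F: group "free_product V G" using grp by (rule group_free_product)
  have "word_class V G [(v, g)] \<in> carrier (free_product V G)"
    if "v \<in> V" "g \<in> carrier (G v)" for v g
    using that by (auto simp: free_product_def syllables_def)
  then have "edge_commutators V E G \<subseteq> carrier (free_product V G)"
    by (auto simp: edge_commutators_def commutator_def)
  then have "graph_relators V E G \<lhd> free_product V G"
    unfolding graph_relators_def using F.group_axioms by (rule normal_normal_closure[rotated])
  then show ?thesis
    unfolding graph_product_def by (rule normal.factorgroup_is_group)
qed

end

theory Submission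
  imports Defs "HOL-Library.Multiset"
begin

text \<open>
  Everything rests on a normal form: two reduced words represent the same element of the graph
  product exactly when one is obtained from the other by a shuffle, that is, by exchanging
  consecutive syllables of adjacent vertices (\<open>reduced_words_shuffle\<close>). It is proved by letting
  syllables act on reduced words from the left. Up to shuffles this action respects the relations
  of the graph product, and a reduced word \<open>w\<close> sends the empty word to \<open>w\<close>. A consequence is that
  reduced words are exactly the words of minimal length representing an element
  (\<open>reduced_if_length_le\<close>).

  Now let \<open>a\<close> and \<open>b\<close> be cyclically reduced words and let \<open>g\<close> be a reduced word with \<open>g a = b g\<close> in the
  graph product. Induction on the length of \<open>g\<close> shows that \<open>b\<close> arises from \<open>a\<close> by shuffles,
  cyclic permutations and conjugations of floating syllables inside their vertex-groups
  (\<open>conj_moves_if_conjugate\<close>). By symmetry \<open>b\<close> is at most as long as \<open>a\<close>.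
  \<^item> Suppose that \<open>g = h s\<close> and \<open>a = t c\<close>, up to shuffles, with \<open>s\<close> and \<open>t\<close> in the same vertex-group. If
    \<open>t\<close> is floating, then \<open>s\<close> only conjugates \<open>t\<close>, and can be removed from \<open>g\<close>. Otherwise rotate \<open>a\<close> to \<open>c t\<close>
    and replace \<open>g\<close> by \<open>h (s t)\<close>. Either \<open>g\<close> gets shorter, or fewer vertices admit such a cancellation
    between \<open>g\<close> and \<open>a\<close>.
  \<^item> If there is no such pair, then \<open>g a\<close> is reduced. As \<open>b g\<close> is not longer, it is reduced too, so the
    two words are shuffles of each other. Hence the last syllable \<open>s\<close> of \<open>g\<close> is a final syllable of
    \<open>g a\<close>: either it is a final syllable of \<open>a\<close>, and rotating \<open>a\<close> absorbs it, or it commutes with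
    \<open>a\<close>. In both cases \<open>g\<close> gets shorter.

  These moves do not change the multiset of vertices of a word, so which vertices are floating does
  not change either. The moves therefore act separately on the floating syllables, whose values are
  conjugated, and on the others, which undergo shuffles and cyclic permutations; this yields the
  words of the theorem (\<open>conj_moves_nonfloating\<close>). Conversely, each of the allowed operations is
  a conjugation, because floating syllables commute with the rest of the word.
\<close>

section \<open>Conjugation in a group\<close>

lemma (in group) inv_conj_cancel:
  assumes "h \<in> carrier G" "g \<in> carrier G"
  shows "inv h \<otimes> (h \<otimes> g \<otimes> inv h) \<otimes> h = g"
proof -
  have "inv h \<otimes> (h \<otimes> g \<otimes> inv h) \<otimes> h = (inv h \<otimes> h) \<otimes> g \<otimes> (inv h \<otimes> h)"
    using assms by (simp only: m_assoc inv_closed m_closed)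
  then show ?thesis using assms by simp
qed

lemma conjugate_in_refl: "group K \<Longrightarrow> x \<in> carrier K \<Longrightarrow> conjugate_in K x x"
proof -
  assume "group K" and x: "x \<in> carrier K"
  then interpret K: group K by simp
  show ?thesis unfolding conjugate_in_def using x by (intro bexI[of _ "\<one>\<^bsub>K\<^esub>"]) simp_all
qed

lemma conjugate_in_trans:
  assumes "group K" "x \<in> carrier K" "conjugate_in K x y" "conjugate_in K y z"
  shows "conjugate_in K x z"
proof -
  interpret K: group K by fact
  obtain h k where h: "h \<in> carrier K" "y = h \<otimes>\<^bsub>K\<^esub> x \<otimes>\<^bsub>K\<^esub> inv\<^bsub>K\<^esub> h"
    and k: "k \<in> carrier K" "z = k \<otimes>\<^bsub>K\<^esub> y \<otimes>\<^bsub>K\<^esub> inv\<^bsub>K\<^esub> k"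
    using assms(3,4) unfolding conjugate_in_def by blast
  then have "z = (k \<otimes>\<^bsub>K\<^esub> h) \<otimes>\<^bsub>K\<^esub> x \<otimes>\<^bsub>K\<^esub> inv\<^bsub>K\<^esub> (k \<otimes>\<^bsub>K\<^esub> h)"
    using assms(2) by (simp add: K.m_assoc K.inv_mult_group)
  then show ?thesis using h(1) k(1) unfolding conjugate_in_def by blast
qed

section \<open>Shuffles and initial syllables\<close>

locale graph_product_data =
  fixes V :: "'v set" and E :: "'v set set" and G :: "'v \<Rightarrow> ('g, 'm) monoid_scheme"
  assumes graph: "simplicial_graph V E"
    and grp: "\<And>v. v \<in> V \<Longrightarrow> group (G v)"
begin

abbreviation adj :: "'v \<Rightarrow> 'v \<Rightarrow> bool" where
  "adj u v \<equiv> {u, v} \<in> E"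

abbreviation words :: "('v \<times> 'g) list set" where
  "words \<equiv> lists (syllables V G)"

(* membership in words is used through its own simplification rules; as classical rules these two
   would dissolve it into statements about single syllables *)
declare in_listsI [rule del] in_listsD [rule del]

lemma adj_irrefl [simp]: "\<not> adj v v" "{v} \<notin> E"
  using graph unfolding simplicial_graph_def by fastforce+

lemma adj_sym: "adj u v \<longleftrightarrow> adj v u"
  by (simp add: insert_commute)

inductive shuffle :: "('v \<times> 'g) list \<Rightarrow> ('v \<times> 'g) list \<Rightarrow> bool" where
  refl [simp]: "shuffle w w"
| swap: "adj (fst s) (fst t) \<Longrightarrow> shuffle (xs @ s # t # ys) (xs @ t # s # ys)"
| trans: "shuffle u v \<Longrightarrow> shuffle v w \<Longrightarrow> shuffle u w"

lemma shuffle_sym: "shuffle v w \<Longrightarrow> shuffle w v"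
proof (induction rule: shuffle.induct)
  case (swap s t xs ys)
  then show ?case using shuffle.swap[of t s xs ys] by (simp add: adj_sym)
qed (auto elim: shuffle.trans[rotated])

lemma shuffle_context: "shuffle v w \<Longrightarrow> shuffle (xs @ v @ ys) (xs @ w @ ys)"
proof (induction rule: shuffle.induct)
  case (swap s t us vs)
  then show ?case using shuffle.swap[of s t "xs @ us" "vs @ ys"] by simp
qed (auto elim: shuffle.trans)

lemma shuffle_Cons: "shuffle v w \<Longrightarrow> shuffle (s # v) (s # w)"
  using shuffle_context[of v w "[s]" "[]"] by simp

lemma shuffle_mset: "shuffle v w \<Longrightarrow> mset v = mset w"
  by (induction rule: shuffle.induct) auto

lemma shuffle_set: "shuffle v w \<Longrightarrow> set v = set w"
  by (metis shuffle_mset set_mset_mset)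

lemma shuffle_length: "shuffle v w \<Longrightarrow> length v = length w"
  by (metis shuffle_mset size_mset)

lemma shuffle_words: "shuffle v w \<Longrightarrow> w \<in> words \<longleftrightarrow> v \<in> words"
  using shuffle_set by (auto simp: in_lists_conv_set)

lemma shuffle_rev: "shuffle v w \<Longrightarrow> shuffle (rev v) (rev w)"
proof (induction rule: shuffle.induct)
  case (swap s t us vs)
  then show ?case using shuffle.swap[of t s "rev vs" "rev us"] by (simp add: adj_sym)
qed (auto elim: shuffle.trans)

lemma shuffle_past:
  assumes "\<And>r. r \<in> set xs \<Longrightarrow> adj (fst r) (fst s)"
  shows "shuffle (s # xs) (xs @ [s])"
  using assms
proof (induction xs)
  case (Cons r xs)
  have "shuffle (s # r # xs) (r # s # xs)"
    using Cons.prems shuffle.swap[of s r "[]" xs] by (simp add: adj_sym)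
  moreover have "shuffle (r # s # xs) (r # xs @ [s])"
    using Cons by (intro shuffle_Cons) auto
  ultimately show ?case by (simp add: shuffle.trans[of _ "r # s # xs"])
qed simp

text \<open>
  The value of the syllable of vertex \<open>v\<close> that shuffles can bring to the beginning of a word, if
  there is one. No syllable of \<open>v\<close> passes another one, since a vertex is not adjacent to itself, so it
  can only be the first one. Syllables that can be brought to the end are treated by reversing
  the word.
\<close>

primrec front :: "'v \<Rightarrow> ('v \<times> 'g) list \<Rightarrow> 'g option" where
  "front v [] = None"
| "front v (s # w) =
    (if fst s = v then Some (snd s) else if adj (fst s) v then front v w else None)"

primrec remove_first :: "'v \<Rightarrow> ('v \<times> 'g) list \<Rightarrow> ('v \<times> 'g) list" where
  "remove_first v [] = []"
| "remove_first v (s # w) = (if fst s = v then w else s # remove_first v w)"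

lemma front_append:
  "front v (xs @ ys) = (case front v xs of Some g \<Rightarrow> Some g
     | None \<Rightarrow> if \<forall>s\<in>set xs. adj (fst s) v then front v ys else None)"
  by (induction xs) auto

lemma front_shuffle: "shuffle w w' \<Longrightarrow> front v w = front v w'"
proof (induction rule: shuffle.induct)
  case (swap s t xs ys)
  then have "front v (s # t # ys) = front v (t # s # ys)"
    using adj_irrefl adj_sym by (cases "fst s = v"; cases "fst t = v"; auto)
  then show ?case by (simp only: front_append)
qed auto

lemma remove_first_shuffle: "shuffle w w' \<Longrightarrow> shuffle (remove_first v w) (remove_first v w')"
proof (induction rule: shuffle.induct)
  case (swap s t xs ys)
  then show ?case
  proof (induction xs)
    case Nil
    then show ?case
      using shuffle.swap[of s t "[]"] adj_irrefl by (cases "fst s = v"; cases "fst t = v"; auto)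
  next
    case (Cons r xs)
    then show ?case using shuffle.swap[of s t xs ys] by (auto intro: shuffle_Cons)
  qed
qed (auto elim: shuffle.trans)

lemma shuffle_front: "front v w = Some g \<Longrightarrow> shuffle w ((v, g) # remove_first v w)"
proof (induction w)
  case (Cons s w)
  show ?case
  proof (cases "fst s = v")
    case True
    then show ?thesis using Cons.prems by (cases s) auto
  next
    case False
    then have a: "adj (fst s) v" "front v w = Some g"
      using Cons.prems by (auto split: if_splits)
    have "shuffle (s # w) (s # (v, g) # remove_first v w)"
      using Cons.IH a by (intro shuffle_Cons) auto
    moreover have "shuffle (s # (v, g) # remove_first v w) ((v, g) # s # remove_first v w)"
      using shuffle.swap[of s "(v, g)" "[]"] a by simp
    ultimately show ?thesis using False by (simp add: shuffle.trans[of _ "s # (v, g) # remove_first v w"])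
  qed
qed simp

lemma shuffle_back:
  assumes "front v (rev w) = Some g"
  shows "\<exists>c. shuffle w (c @ [(v, g)])"
  using shuffle_rev[OF shuffle_front[OF assms]] by auto

lemma front_remove_first: "adj u v \<Longrightarrow> front v (remove_first u w) = front v w"
  by (induction w) auto

lemma remove_first_commute:
  "u \<noteq> v \<Longrightarrow> remove_first u (remove_first v w) = remove_first v (remove_first u w)"
  by (induction w) auto

text \<open>The link with the descriptions of (cyclically) reduced words by positions.\<close>

lemma front_split:
  "front v w \<noteq> None \<longleftrightarrow>
    (\<exists>xs s ys. w = xs @ s # ys \<and> fst s = v \<and> (\<forall>r\<in>set xs. adj (fst r) v))"
proof (induction w)
  case (Cons t w)
  show ?case (is "?L \<longleftrightarrow> ?R")
  proof
    assume ?L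
    show ?R
    proof (cases "fst t = v")
      case True
      then have "t # w = [] @ t # w \<and> fst t = v \<and> (\<forall>r\<in>set []. adj (fst r) v)" by simp
      then show ?thesis by blast
    next
      case False
      with \<open>?L\<close> have "adj (fst t) v" "front v w \<noteq> None" by (auto split: if_splits)
      then obtain xs s ys where "w = xs @ s # ys" "fst s = v" "\<forall>r\<in>set xs. adj (fst r) v"
        using Cons.IH by auto
      then have "t # w = (t # xs) @ s # ys \<and> fst s = v \<and> (\<forall>r\<in>set (t # xs). adj (fst r) v)"
        using \<open>adj (fst t) v\<close> by simp
      then show ?thesis by blast
    qed
  next
    assume ?R
    then obtain xs s ys where *: "t # w = xs @ s # ys" "fst s = v" "\<forall>r\<in>set xs. adj (fst r) v"
      by blast
    show ?L
    proof (cases xs)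
      case (Cons t' xs')
      then have "w = xs' @ s # ys" using * by simp
      then have "front v w \<noteq> None" using Cons.IH * Cons by (metis list.set_intros(2))
      then show ?thesis using * Cons by auto
    qed (use * in auto)
  qed
qed simp

section \<open>Reduced words\<close>

text \<open>
  Graphical reducedness, without the exceptional representation of the identity by a trivial
  syllable: here the empty word represents the identity.
\<close>

primrec reduced :: "('v \<times> 'g) list \<Rightarrow> bool" where
  "reduced [] \<longleftrightarrow> True"
| "reduced (s # w) \<longleftrightarrow> snd s \<noteq> \<one>\<^bsub>G (fst s)\<^esub> \<and> front (fst s) w = None \<and> reduced w"

lemma reduced_shuffle:
  assumes "shuffle w w'"
  shows "reduced w \<longleftrightarrow> reduced w'"
  using assms
proof (induction rule: shuffle.induct)
  case (swap s t xs ys)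
  then show ?case
  proof (induction xs)
    case Nil
    then have "fst s \<noteq> fst t" "adj (fst t) (fst s)" using adj_irrefl adj_sym by metis+
    then show ?case using Nil by auto
  next
    case (Cons r xs)
    then show ?case using front_shuffle[OF shuffle.swap[of s t xs ys], of "fst r"] by simp
  qed
qed auto

lemma reduced_appendD:
  assumes "reduced (xs @ ys)"
  shows "reduced xs" and "reduced ys"
  using assms by (induction xs) (auto simp: front_append split: option.splits)

text \<open>
  Two syllables of the same vertex that can be brought together either lie in the same factor, or
  the one on the left is final in \<open>xs\<close> and the one on the right initial in \<open>ys\<close>.
\<close>

lemma reduced_appendI:
  assumes "reduced xs" "reduced ys" "\<And>v. front v (rev xs) = None \<or> front v ys = None"
  shows "reduced (xs @ ys)"
  using assms
proof (induction xs)
  case (Cons s xs)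
  have "front v (rev xs) = None \<or> front v ys = None" for v
    using Cons.prems(3)[of v] by (auto simp: front_append split: option.splits)
  with Cons have "reduced (xs @ ys)" by simp
  moreover have "front (fst s) (xs @ ys) = None"
    using Cons.prems(1) Cons.prems(3)[of "fst s"]
    by (auto simp: front_append split: option.splits)
  ultimately show ?case using Cons.prems by simp
qed simp

lemma reduced_rev: "reduced w \<Longrightarrow> reduced (rev w)"
  by (induction w) (auto intro!: reduced_appendI split: if_splits)

lemma reduced_replace:
  assumes "fst t = fst t'" "snd t' \<noteq> \<one>\<^bsub>G (fst t')\<^esub>" "reduced (xs @ t # ys)"
  shows "reduced (xs @ t' # ys)"
  using assms(3)
proof (induction xs)
  case (Cons s xs)
  then show ?case using assms(1) by (auto simp: front_append split: option.splits if_splits)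
qed (use assms in auto)

lemma reduced_iff:
  "reduced w \<longleftrightarrow> (\<forall>s\<in>set w. snd s \<noteq> \<one>\<^bsub>G (fst s)\<^esub>) \<and>
    (\<forall>xs s ys t zs. w = xs @ s # ys @ t # zs \<longrightarrow> fst s = fst t \<longrightarrow>
       (\<exists>r\<in>set ys. \<not> adj (fst r) (fst s)))"
  (is "_ \<longleftrightarrow> _ \<and> ?P w")
proof (induction w)
  case (Cons u w)
  have "?P (u # w) \<longleftrightarrow> front (fst u) w = None \<and> ?P w"
  proof (intro iffI conjI)
    assume P: "?P (u # w)"
    show "front (fst u) w = None"
    proof (rule ccontr)
      assume "front (fst u) w \<noteq> None"
      then obtain xs s ys where "w = xs @ s # ys" "fst s = fst u" "\<forall>r\<in>set xs. adj (fst r) (fst u)"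
        using front_split by blast
      then show False using P[rule_format, of "[]" u xs s ys] by auto
    qed
    show "?P w" using P by (metis append_Cons)
  next
    assume P: "front (fst u) w = None \<and> ?P w"
    show "?P (u # w)"
    proof (intro allI impI)
      fix xs s ys t zs assume *: "u # w = xs @ s # ys @ t # zs" "fst s = fst t"
      show "\<exists>r\<in>set ys. \<not> adj (fst r) (fst s)"
      proof (cases xs)
        case Nil
        then show ?thesis using P * front_split[of "fst u" w] by (metis append_Nil list.inject)
      next
        case (Cons u' xs')
        then have "w = xs' @ s # ys @ t # zs" using * by simp
        then show ?thesis using P * by blast
      qed
    qed
  qed
  then show ?case using Cons.IH by auto
qed simp

lemma index_condition_iff:
  "(\<forall>i j. i < j \<and> j < length w \<longrightarrow> fst (w ! i) \<noteq> fst (w ! j) \<or>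
      (\<exists>k. i < k \<and> k < j \<and> \<not> adj (fst (w ! k)) (fst (w ! i)))) \<longleftrightarrow>
   (\<forall>xs s ys t zs. w = xs @ s # ys @ t # zs \<longrightarrow> fst s = fst t \<longrightarrow>
       (\<exists>r\<in>set ys. \<not> adj (fst r) (fst s)))"
  (is "?L \<longleftrightarrow> ?R")
proof
  assume L: ?L
  show ?R
  proof (intro allI impI)
    fix xs s ys t zs assume w: "w = xs @ s # ys @ t # zs" and st: "fst s = fst t"
    let ?i = "length xs" and ?j = "Suc (length xs + length ys)"
    have n: "w ! ?i = s" "w ! ?j = t" "?j < length w"
      by (simp_all add: w nth_append)
    then obtain k where k: "?i < k" "k < ?j" "\<not> adj (fst (w ! k)) (fst s)"
      using L[rule_format, of ?i ?j] st by auto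
    then have "w ! k \<in> set ys"
      by (auto simp: w nth_append nth_Cons' Suc_diff_Suc)
    with k show "\<exists>r\<in>set ys. \<not> adj (fst r) (fst s)" by blast
  qed
next
  assume R: ?R
  show ?L
  proof (intro allI impI, subst disj_imp, intro impI)
    fix i j assume ij: "i < j \<and> j < length w" and "\<not> fst (w ! i) \<noteq> fst (w ! j)"
    let ?ys = "take (j - Suc i) (drop (Suc i) w)"
    have "j - Suc i < length w - Suc i" using ij by linarith
    then have "drop (Suc i) w = ?ys @ w ! j # drop (Suc j) w"
      using ij id_take_nth_drop[of "j - Suc i" "drop (Suc i) w"] by simp
    then have "w = take i w @ w ! i # ?ys @ w ! j # drop (Suc j) w"
      using ij id_take_nth_drop[of i w] by simp
    then obtain r where "r \<in> set ?ys" "\<not> adj (fst r) (fst (w ! i))"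
      using R \<open>\<not> fst (w ! i) \<noteq> fst (w ! j)\<close> by blast
    moreover then obtain k where "k < j - Suc i" "r = w ! (Suc i + k)"
      using ij by (auto simp: in_set_conv_nth)
    ultimately show "\<exists>k. i < k \<and> k < j \<and> \<not> adj (fst (w ! k)) (fst (w ! i))"
      by (intro exI[of _ "Suc i + k"]) auto
  qed
qed

lemma graphically_reduced_iff:
  "graphically_reduced V E G w \<longleftrightarrow>
    w \<in> words \<and> w \<noteq> [] \<and> (reduced w \<or> (\<exists>v. w = [(v, \<one>\<^bsub>G v\<^esub>)]))"
proof -
  let ?I = "\<forall>i j. i < j \<and> j < length w \<longrightarrow> fst (w ! i) \<noteq> fst (w ! j) \<or>
      (\<exists>k. i < k \<and> k < j \<and> \<not> adj (fst (w ! k)) (fst (w ! i)))"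
  have "reduced w \<longleftrightarrow> (\<forall>i<length w. snd (w ! i) \<noteq> \<one>\<^bsub>G (fst (w ! i))\<^esub>) \<and> ?I"
    unfolding index_condition_iff reduced_iff
    by (intro conj_cong HOL.refl) (simp add: all_set_conv_all_nth)
  moreover have "(length w = 1 \<and> snd (w ! 0) = \<one>\<^bsub>G (fst (w ! 0))\<^esub>) \<longleftrightarrow> (\<exists>v. w = [(v, \<one>\<^bsub>G v\<^esub>)])"
    by (cases w) (auto simp: prod_eq_iff)
  moreover have "(\<exists>v. w = [(v, \<one>\<^bsub>G v\<^esub>)]) \<Longrightarrow> ?I" by auto
  moreover have "length w \<ge> 1 \<longleftrightarrow> w \<noteq> []" by (cases w) auto
  ultimately show ?thesis unfolding graphically_reduced_def by argo
qed

section \<open>The action on reduced words\<close>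

text \<open>
  A reduced word \<open>w\<close> is split, up to shuffles, into its component \<open>head v w\<close> in the vertex-group
  of \<open>v\<close>, which is trivial if no syllable of \<open>v\<close> is initial, and a reduced word \<open>tail v w\<close> without an
  initial syllable of \<open>v\<close>. A syllable of \<open>v\<close> acts by multiplying the component, as in the proof of
  van der Waerden for the normal form in free products.
\<close>

definition head :: "'v \<Rightarrow> ('v \<times> 'g) list \<Rightarrow> 'g" where
  "head v w = (case front v w of None \<Rightarrow> \<one>\<^bsub>G v\<^esub> | Some g \<Rightarrow> g)"

definition tail :: "'v \<Rightarrow> ('v \<times> 'g) list \<Rightarrow> ('v \<times> 'g) list" where
  "tail v w = (if front v w = None then w else remove_first v w)"

definition prepend :: "'v \<Rightarrow> 'g \<Rightarrow> ('v \<times> 'g) list \<Rightarrow> ('v \<times> 'g) list" where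
  "prepend v g w = (if g = \<one>\<^bsub>G v\<^esub> then w else (v, g) # w)"

definition act_syl :: "'v \<times> 'g \<Rightarrow> ('v \<times> 'g) list \<Rightarrow> ('v \<times> 'g) list" where
  "act_syl s w = prepend (fst s) (snd s \<otimes>\<^bsub>G (fst s)\<^esub> head (fst s) w) (tail (fst s) w)"

definition act :: "('v \<times> 'g) list \<Rightarrow> ('v \<times> 'g) list \<Rightarrow> ('v \<times> 'g) list" where
  "act w x = foldr act_syl w x"

lemma act_simps [simp]: "act [] x = x" "act (s # w) x = act_syl s (act w x)"
    "act (u @ w) x = act u (act w x)"
  by (simp_all add: act_def)

lemma front_in_set: "front v w = Some g \<Longrightarrow> (v, g) \<in> set w"
  by (induction w) (auto split: if_splits)

lemma words_syllableD: "w \<in> words \<Longrightarrow> (v, g) \<in> set w \<Longrightarrow> v \<in> V \<and> g \<in> carrier (G v)"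
  by (auto simp: syllables_def in_lists_conv_set)

lemma head_carrier: "w \<in> words \<Longrightarrow> v \<in> V \<Longrightarrow> head v w \<in> carrier (G v)"
  using words_syllableD[OF _ front_in_set] group.is_monoid[OF grp]
  by (auto simp: head_def monoid.one_closed split: option.split)

lemma set_remove_first: "set (remove_first v w) \<subseteq> set w"
  by (induction w) auto

lemma tail_words: "w \<in> words \<Longrightarrow> tail v w \<in> words"
  using set_remove_first[of v w] by (auto simp: tail_def in_lists_conv_set)

lemma act_syl_words:
  assumes "s \<in> syllables V G" "w \<in> words"
  shows "act_syl s w \<in> words"
proof -
  obtain v g where s: "s = (v, g)" "v \<in> V" "g \<in> carrier (G v)"
    using assms(1) by (auto simp: syllables_def)
  interpret Gv: group "G v" using grp s(2) .
  show ?thesis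
    using s tail_words[OF assms(2)] head_carrier[OF assms(2) s(2)]
    by (auto simp: act_syl_def prepend_def syllables_def)
qed

lemma act_words: "w \<in> words \<Longrightarrow> x \<in> words \<Longrightarrow> act w x \<in> words"
  by (induction w) (auto intro: act_syl_words)

lemma tail_reduced:
  assumes "reduced w"
  shows "reduced (tail v w)" and "front v (tail v w) = None"
  using assms reduced_shuffle[OF shuffle_front, of v w] by (auto simp: tail_def)

lemma act_syl_reduced: "reduced w \<Longrightarrow> reduced (act_syl s w)"
  using tail_reduced by (auto simp: act_syl_def prepend_def)

lemma act_reduced: "reduced x \<Longrightarrow> reduced (act w x)"
  by (induction w) (auto intro: act_syl_reduced)

lemma act_syl_shuffle: "shuffle w w' \<Longrightarrow> shuffle (act_syl s w) (act_syl s w')"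
  using front_shuffle[of w w' "fst s"] remove_first_shuffle[of w w' "fst s"]
  by (auto simp: act_syl_def prepend_def head_def tail_def intro: shuffle_Cons)

lemma act_shuffle: "shuffle x y \<Longrightarrow> shuffle (act w x) (act w y)"
  by (induction w) (auto intro: act_syl_shuffle)

lemma head_prepend: "front v w = None \<Longrightarrow> head v (prepend v g w) = g"
  by (simp add: head_def prepend_def)

lemma tail_prepend: "front v w = None \<Longrightarrow> tail v (prepend v g w) = w"
  by (simp add: tail_def prepend_def)

lemma act_syl_mult:
  assumes "reduced w" "w \<in> words" "v \<in> V" "g \<in> carrier (G v)" "h \<in> carrier (G v)"
  shows "act_syl (v, g) (act_syl (v, h) w) = act_syl (v, g \<otimes>\<^bsub>G v\<^esub> h) w"
proof -
  interpret Gv: group "G v" using grp assms(3) .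
  show ?thesis
    using assms head_carrier[OF assms(2,3)] tail_reduced(2)[OF assms(1)]
    by (simp add: act_syl_def head_prepend tail_prepend Gv.m_assoc)
qed

lemma act_syl_one:
  assumes "reduced w" "w \<in> words" "v \<in> V"
  shows "shuffle (act_syl (v, \<one>\<^bsub>G v\<^esub>) w) w"
proof -
  interpret Gv: group "G v" using grp assms(3) .
  show ?thesis
  proof (cases "front v w")
    case None
    then show ?thesis by (simp add: act_syl_def prepend_def head_def tail_def)
  next
    case (Some g)
    then have "g \<noteq> \<one>\<^bsub>G v\<^esub>" "g \<in> carrier (G v)"
      using assms reduced_shuffle[OF shuffle_front[OF Some]] head_carrier[OF assms(2,3)]
      by (auto simp: head_def)
    with Some show ?thesis
      using shuffle_sym[OF shuffle_front[OF Some]]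
      by (simp add: act_syl_def prepend_def head_def tail_def)
  qed
qed

lemma head_prepend_adj: "adj u v \<Longrightarrow> head u (prepend v g w) = head u w"
  by (auto simp: head_def prepend_def adj_sym)

lemma tail_prepend_adj: "adj u v \<Longrightarrow> tail u (prepend v g w) = prepend v g (tail u w)"
  by (auto simp: tail_def prepend_def adj_sym)

lemma head_tail_adj: "adj u v \<Longrightarrow> head u (tail v w) = head u w"
  by (simp add: head_def tail_def front_remove_first adj_sym)

lemma tail_tail_adj: "adj u v \<Longrightarrow> tail u (tail v w) = tail v (tail u w)"
  using remove_first_commute[of u v w] front_remove_first[of u v w] front_remove_first[of v u w]
  by (cases "u = v") (auto simp: tail_def adj_sym)

text \<open>
  Heads and tails at two adjacent vertices do not interfere, so both orders produce the same two
  components in front of the same rest.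
\<close>

lemma act_syl_commute:
  assumes "adj (fst s) (fst t)"
  shows "shuffle (act_syl s (act_syl t w)) (act_syl t (act_syl s w))"
proof -
  have "adj (fst t) (fst s)" using assms by (simp add: adj_sym)
  moreover have "shuffle (prepend (fst s) g (prepend (fst t) h x))
      (prepend (fst t) h (prepend (fst s) g x))" for g h x
    using assms shuffle.swap[of "(fst s, g)" "(fst t, h)" "[]"] by (simp add: prepend_def)
  ultimately show ?thesis
    using assms unfolding act_syl_def
    by (simp only: head_prepend_adj tail_prepend_adj head_tail_adj tail_tail_adj)
qed

lemma act_word_eq:
  assumes "word_eq V G w w'" "reduced x" "x \<in> words"
  shows "shuffle (act w x) (act w' x)"
  using assms
proof (induction rule: word_eq.induct)
  case (delete xs ys v)
  then show ?case
    by (simp add: act_shuffle act_syl_one act_reduced act_words)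
next
  case (merge xs ys v g h)
  then show ?case by (simp add: act_syl_mult act_reduced act_words)
next
  case (sym xs ys)
  then show ?case by (auto intro: shuffle_sym)
next
  case (trans xs ys zs)
  then show ?case by (auto elim: shuffle.trans)
qed simp

lemma act_self:
  assumes "reduced w" "w \<in> words"
  shows "act w [] = w"
  using assms
proof (induction w)
  case (Cons s w)
  obtain v g where s: "s = (v, g)" "v \<in> V" "g \<in> carrier (G v)"
    using Cons.prems by (auto simp: syllables_def)
  interpret Gv: group "G v" using grp s(2) .
  show ?case using Cons s by (simp add: act_syl_def prepend_def head_def tail_def)
qed simp

lemma length_remove_first_front: "front v w \<noteq> None \<Longrightarrow> length (remove_first v w) < length w"
  using shuffle_length[OF shuffle_front, of v w] by auto

lemma length_act: "length (act w []) \<le> length w"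
proof (induction w)
  case (Cons s w)
  have "length (act_syl s (act w [])) \<le> Suc (length (act w []))"
    using length_remove_first_front[of "fst s" "act w []"]
    by (auto simp: act_syl_def prepend_def tail_def)
  then show ?case using Cons by simp
qed simp

text \<open>
  A syllable makes a word longer only when it is nontrivial and has nothing to merge with. If no
  syllable of \<open>w\<close> loses length when acting, then each of them is prepended to a word without an initial
  syllable of its vertex, which is the definition of reducedness.
\<close>

lemma reduced_if_length_act:
  assumes "w \<in> words" "length (act w []) = length w"
  shows "reduced w"
  using assms
proof (induction w)
  case (Cons s w)
  obtain v g where s: "s = (v, g)" "v \<in> V" "g \<in> carrier (G v)"
    using Cons by (auto simp: syllables_def)
  interpret Gv: group "G v" using grp s(2) .
  let ?x = "act w []"
  have *: "length (act_syl s ?x) = Suc (length w)" "length ?x \<le> length w"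
    using Cons.prems length_act[of w] by simp_all
  have "front (fst s) ?x = None"
  proof (rule ccontr)
    assume "front (fst s) ?x \<noteq> None"
    then have "length (act_syl s ?x) \<le> length ?x"
      using length_remove_first_front[of "fst s" ?x] by (auto simp: act_syl_def prepend_def tail_def)
    then show False using * by simp
  qed
  moreover then have "snd s \<noteq> \<one>\<^bsub>G (fst s)\<^esub>" "length ?x = length w"
    using * s by (auto simp: act_syl_def prepend_def tail_def head_def split: if_splits)
  moreover then have "reduced w" using Cons by simp
  ultimately show ?case using Cons act_self[of w] by simp
qed simp

section \<open>Words and elements of the graph product\<close>

abbreviation "F \<equiv> free_product V G"
abbreviation "R \<equiv> graph_relators V E G"
abbreviation "H \<equiv> graph_product V E G"
abbreviation "elt \<equiv> word_elem V E G"

sublocale F: group F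
  using grp by (rule group_free_product)

sublocale H: group H
  using grp by (rule group_graph_product)

lemma word_class_carrier [simp]: "w \<in> words \<Longrightarrow> word_class V G w \<in> carrier F"
  by (simp add: free_product_def)

lemma word_class_mult:
  "u \<in> words \<Longrightarrow> w \<in> words \<Longrightarrow> word_class V G u \<otimes>\<^bsub>F\<^esub> word_class V G w = word_class V G (u @ w)"
  using grp by (rule free_product_mult)

lemma one_free_product: "\<one>\<^bsub>F\<^esub> = word_class V G []"
  by (simp add: free_product_def)

lemma edge_commutators_carrier: "edge_commutators V E G \<subseteq> carrier F"
proof -
  have "word_class V G [(v, g)] \<in> carrier F" if "v \<in> V" "g \<in> carrier (G v)" for v g
    using that by (auto simp: free_product_def syllables_def)
  then show ?thesis by (auto simp: edge_commutators_def commutator_def)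
qed

sublocale R: normal R F
  unfolding graph_relators_def
  using F.group_axioms edge_commutators_carrier by (rule normal_normal_closure)

text \<open>
  The kernel of the action. The relators lie in its image in the free product, because that image is
  a normal subgroup that contains the commutators of adjacent syllables. This is what makes the
  action well defined on elements of the graph product.
\<close>

definition trivially_acting :: "('v \<times> 'g) list set" where
  "trivially_acting = {w \<in> words. \<forall>x\<in>words. reduced x \<longrightarrow> shuffle (act w x) x}"

lemma word_class_inverse:
  assumes "w \<in> words"
  obtains u where "u \<in> words" "inv\<^bsub>F\<^esub> word_class V G w = word_class V G u"
    "word_eq V G (u @ w) []" "word_eq V G (w @ u) []"
proof -
  obtain u where u: "u \<in> words" "word_eq V G (u @ w) []"
    using word_inverse[OF grp assms] by blast
  then have "word_class V G u \<otimes>\<^bsub>F\<^esub> word_class V G w = \<one>\<^bsub>F\<^esub>"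
    using assms word_class_eq_iff[of "u @ w" V G "[]"] by (simp add: word_class_mult one_free_product)
  then have inv: "inv\<^bsub>F\<^esub> word_class V G w = word_class V G u"
    using u assms by (intro F.inv_equality) simp_all
  then have "word_class V G w \<otimes>\<^bsub>F\<^esub> word_class V G u = \<one>\<^bsub>F\<^esub>"
    using assms by (metis F.r_inv word_class_carrier)
  then have "word_eq V G (w @ u) []"
    using assms u(1) word_class_eq_iff[of "w @ u" V G "[]"]
    by (simp add: word_class_mult one_free_product)
  with u inv that show thesis by blast
qed

lemma act_inverse:
  assumes "word_eq V G (u @ w) []" "reduced x" "x \<in> words"
  shows "shuffle (act u (act w x)) x"
  using act_word_eq[OF assms] by simp

lemma normal_trivially_acting: "word_class V G ` trivially_acting \<lhd> F"
proof -
  let ?N = "word_class V G ` trivially_acting"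
  have "subgroup ?N F"
  proof (rule F.subgroupI)
    show "?N \<subseteq> carrier F" by (auto simp: trivially_acting_def)
    have "[] \<in> trivially_acting" by (simp add: trivially_acting_def)
    then show "?N \<noteq> {}" by blast
  next
    fix a assume "a \<in> ?N"
    then obtain w where a: "a = word_class V G w" and w: "w \<in> words"
      "\<And>x. x \<in> words \<Longrightarrow> reduced x \<Longrightarrow> shuffle (act w x) x"
      by (auto simp: trivially_acting_def)
    obtain u where u: "u \<in> words" "inv\<^bsub>F\<^esub> word_class V G w = word_class V G u"
      "word_eq V G (u @ w) []"
      using word_class_inverse[OF w(1)] by blast
    have "shuffle (act u x) x" if "x \<in> words" "reduced x" for x
      using act_shuffle[OF shuffle_sym[OF w(2)[OF that]], of u] act_inverse[OF u(3) that(2,1)]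
      by (rule shuffle.trans)
    then show "inv\<^bsub>F\<^esub> a \<in> ?N" using a u by (auto simp: trivially_acting_def)
  next
    fix a b assume "a \<in> ?N" "b \<in> ?N"
    then obtain u w where *: "a = word_class V G u" "b = word_class V G w"
      "u \<in> trivially_acting" "w \<in> trivially_acting" by blast
    have "shuffle (act u (act w x)) x" if "x \<in> words" "reduced x" for x
    proof (rule shuffle.trans)
      show "shuffle (act w x) x" using * that by (simp add: trivially_acting_def)
      then show "shuffle (act u (act w x)) (act w x)"
        using * that by (simp add: trivially_acting_def act_words act_reduced)
    qed
    then have "u @ w \<in> trivially_acting" using * by (simp add: trivially_acting_def)
    then show "a \<otimes>\<^bsub>F\<^esub> b \<in> ?N" using * by (auto simp: trivially_acting_def word_class_mult)
  qed
  then show ?thesis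
  proof (rule F.normal_invI)
    fix c a assume "c \<in> carrier F" "a \<in> ?N"
    then obtain u w where *: "c = word_class V G u" "a = word_class V G w" "u \<in> words"
      "w \<in> trivially_acting"
      by (auto simp: free_product_def)
    obtain u' where u': "u' \<in> words" "inv\<^bsub>F\<^esub> word_class V G u = word_class V G u'"
      "word_eq V G (u @ u') []"
      using word_class_inverse[OF *(3)] by blast
    have "shuffle (act u (act w (act u' x))) x" if "x \<in> words" "reduced x" for x
    proof (rule shuffle.trans)
      show "shuffle (act u (act w (act u' x))) (act u (act u' x))"
        using * u' that by (intro act_shuffle) (simp add: trivially_acting_def act_words act_reduced)
      show "shuffle (act u (act u' x)) x" using act_inverse[OF u'(3) that(2,1)] .
    qed
    then have "u @ w @ u' \<in> trivially_acting"
      using * u'(1) by (simp add: trivially_acting_def)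
    then show "c \<otimes>\<^bsub>F\<^esub> a \<otimes>\<^bsub>F\<^esub> inv\<^bsub>F\<^esub> c \<in> ?N"
      using * u' by (auto simp: trivially_acting_def word_class_mult)
  qed
qed

lemma edge_commutators_act: "edge_commutators V E G \<subseteq> word_class V G ` trivially_acting"
proof
  fix c assume "c \<in> edge_commutators V E G"
  then obtain u v g h where c: "c = commutator F (word_class V G [(u, g)]) (word_class V G [(v, h)])"
    and uv: "u \<in> V" "v \<in> V" "adj u v" "g \<in> carrier (G u)" "h \<in> carrier (G v)"
    by (auto simp: edge_commutators_def)
  have w: "[(u, g)] \<in> words" "[(v, h)] \<in> words" using uv by (auto simp: syllables_def)
  obtain s' where s': "s' \<in> words" "inv\<^bsub>F\<^esub> word_class V G [(u, g)] = word_class V G s'"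
    "word_eq V G ([(u, g)] @ s') []"
    using word_class_inverse[OF w(1)] by blast
  obtain t' where t': "t' \<in> words" "inv\<^bsub>F\<^esub> word_class V G [(v, h)] = word_class V G t'"
    "word_eq V G ([(v, h)] @ t') []"
    using word_class_inverse[OF w(2)] by blast
  have c': "c = word_class V G ([(u, g)] @ [(v, h)] @ s' @ t')"
    unfolding c commutator_def s'(2) t'(2) using w s'(1) t'(1) by (simp add: word_class_mult)
  have "shuffle (act ([(u, g)] @ [(v, h)] @ s' @ t') x) x" if "x \<in> words" "reduced x" for x
  proof -
    have "shuffle (act_syl (u, g) (act_syl (v, h) (act s' (act t' x))))
        (act_syl (v, h) (act_syl (u, g) (act s' (act t' x))))"
      using uv by (intro act_syl_commute) simp
    moreover have "shuffle (act_syl (v, h) (act_syl (u, g) (act s' (act t' x))))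
        (act_syl (v, h) (act t' x))"
      using act_inverse[OF s'(3)] t'(1) that
      by (intro act_syl_shuffle) (simp add: act_reduced act_words)
    moreover have "shuffle (act_syl (v, h) (act t' x)) x"
      using act_inverse[OF t'(3) that(2,1)] by simp
    ultimately show ?thesis by (auto elim: shuffle.trans)
  qed
  then have "[(u, g)] @ [(v, h)] @ s' @ t' \<in> trivially_acting"
    using w s'(1) t'(1) by (simp add: trivially_acting_def)
  then show "c \<in> word_class V G ` trivially_acting" using c' by blast
qed

lemma relators_act: "R \<subseteq> word_class V G ` trivially_acting"
  unfolding graph_relators_def normal_closure_def
  using normal_trivially_acting edge_commutators_act by blast

lemma elt_coset: "w \<in> words \<Longrightarrow> elt w = R #>\<^bsub>F\<^esub> word_class V G w"
proof (induction w)
  case Nil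
  show ?case
    using F.coset_mult_one[OF R.subset]
    by (simp add: word_elem_def graph_product_def FactGroup_def one_free_product)
next
  case (Cons s w)
  then have "elt (s # w) = (R #>\<^bsub>F\<^esub> word_class V G [s]) <#>\<^bsub>F\<^esub> (R #>\<^bsub>F\<^esub> word_class V G w)"
    by (simp add: word_elem_def graph_product_def syllable_elem_def FactGroup_def)
  also have "\<dots> = R #>\<^bsub>F\<^esub> (word_class V G [s] \<otimes>\<^bsub>F\<^esub> word_class V G w)"
    using Cons by (intro R.rcos_sum) simp_all
  also have "word_class V G [s] \<otimes>\<^bsub>F\<^esub> word_class V G w = word_class V G (s # w)"
    using Cons by (subst word_class_mult) simp_all
  finally show ?case .
qed

lemma elt_eq_act:
  assumes "u \<in> words" "w \<in> words" "elt u = elt w" "x \<in> words" "reduced x"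
  shows "shuffle (act u x) (act w x)"
proof -
  have "word_class V G u \<in> R #>\<^bsub>F\<^esub> word_class V G w"
    using assms F.rcos_self[OF _ R.subgroup_axioms, of "word_class V G u"] by (simp add: elt_coset)
  then obtain n where n: "n \<in> R" "word_class V G u = n \<otimes>\<^bsub>F\<^esub> word_class V G w"
    by (auto simp: r_coset_def)
  then obtain r where r: "n = word_class V G r" "r \<in> trivially_acting" using relators_act by blast
  then have "word_eq V G u (r @ w)"
    using n assms word_class_eq_iff[of u V G] by (simp add: trivially_acting_def word_class_mult)
  then have "shuffle (act u x) (act r (act w x))"
    using act_word_eq[of u "r @ w" x] assms by simp
  moreover have "shuffle (act r (act w x)) (act w x)"
    using r assms by (simp add: trivially_acting_def act_words act_reduced)
  ultimately show ?thesis by (rule shuffle.trans)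
qed

lemma elt_carrier [simp]: "w \<in> words \<Longrightarrow> elt w \<in> carrier H"
  by (simp add: elt_coset graph_product_def FactGroup_def F.rcosetsI R.subset)

lemma elt_append:
  assumes "u \<in> words" "w \<in> words"
  shows "elt (u @ w) = elt u \<otimes>\<^bsub>H\<^esub> elt w"
proof -
  have "elt u \<otimes>\<^bsub>H\<^esub> elt w = (R #>\<^bsub>F\<^esub> word_class V G u) <#>\<^bsub>F\<^esub> (R #>\<^bsub>F\<^esub> word_class V G w)"
    using assms by (simp add: elt_coset graph_product_def FactGroup_def)
  also have "\<dots> = R #>\<^bsub>F\<^esub> (word_class V G u \<otimes>\<^bsub>F\<^esub> word_class V G w)"
    using assms by (intro R.rcos_sum) simp_all
  finally show ?thesis using assms by (simp add: elt_coset word_class_mult)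
qed

lemma elt_Nil [simp]: "elt [] = \<one>\<^bsub>H\<^esub>"
  by (simp add: word_elem_def)

lemma elt_word_eq: "u \<in> words \<Longrightarrow> w \<in> words \<Longrightarrow> word_eq V G u w \<Longrightarrow> elt u = elt w"
  using word_class_eq_iff[of u V G w] by (simp add: elt_coset)

lemma elt_context:
  "u \<in> words \<Longrightarrow> w \<in> words \<Longrightarrow> elt u = elt w \<Longrightarrow> xs \<in> words \<Longrightarrow> ys \<in> words \<Longrightarrow>
    elt (xs @ u @ ys) = elt (xs @ w @ ys)"
  by (simp add: elt_append)

lemma elt_one: "v \<in> V \<Longrightarrow> elt [(v, \<one>\<^bsub>G v\<^esub>)] = \<one>\<^bsub>H\<^esub>"
  using elt_word_eq[of "[(v, \<one>\<^bsub>G v\<^esub>)]" "[]"] word_eq.delete[of "[]" V G "[]" v]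
    group.is_monoid[OF grp, of v]
  by (simp add: syllables_def monoid.one_closed)

lemma elt_merge:
  assumes "v \<in> V" "g \<in> carrier (G v)" "h \<in> carrier (G v)"
  shows "elt [(v, g), (v, h)] = elt [(v, g \<otimes>\<^bsub>G v\<^esub> h)]"
  using assms elt_word_eq[of "[(v, g), (v, h)]" "[(v, g \<otimes>\<^bsub>G v\<^esub> h)]"]
    word_eq.merge[of "[]" V G "[]" v g h] group.is_monoid[OF grp, of v]
  by (simp add: syllables_def monoid.m_closed)

lemma elt_swap:
  assumes "adj (fst s) (fst t)" "s \<in> syllables V G" "t \<in> syllables V G"
  shows "elt [s, t] = elt [t, s]"
proof -
  let ?x = "word_class V G [s]" and ?y = "word_class V G [t]"
  have xy: "?x \<in> carrier F" "?y \<in> carrier F" using assms by simp_all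
  have "commutator F ?x ?y \<in> edge_commutators V E G"
    using assms unfolding edge_commutators_def by (cases s; cases t) (auto simp: syllables_def)
  then have c: "commutator F ?x ?y \<in> R"
    unfolding graph_relators_def normal_closure_def by blast
  then have "commutator F ?x ?y \<in> carrier F" using R.subset by blast
  moreover have "?x \<otimes>\<^bsub>F\<^esub> ?y = commutator F ?x ?y \<otimes>\<^bsub>F\<^esub> (?y \<otimes>\<^bsub>F\<^esub> ?x)"
  proof -
    have "inv\<^bsub>F\<^esub> ?y \<otimes>\<^bsub>F\<^esub> (?y \<otimes>\<^bsub>F\<^esub> ?x) = ?x"
      using xy by (simp flip: F.m_assoc)
    then show ?thesis using xy by (simp add: commutator_def F.m_assoc)
  qed
  ultimately have "R #>\<^bsub>F\<^esub> (?x \<otimes>\<^bsub>F\<^esub> ?y) = (R #>\<^bsub>F\<^esub> commutator F ?x ?y) #>\<^bsub>F\<^esub> (?y \<otimes>\<^bsub>F\<^esub> ?x)"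
    using xy R.subset by (simp add: F.coset_mult_assoc)
  also have "R #>\<^bsub>F\<^esub> commutator F ?x ?y = R"
    using c R.subgroup_axioms F.group_axioms by (simp add: subgroup.rcos_const)
  finally show ?thesis using assms by (simp add: elt_coset word_class_mult)
qed

lemma elt_shuffle: "shuffle u w \<Longrightarrow> u \<in> words \<Longrightarrow> elt u = elt w"
proof (induction rule: shuffle.induct)
  case (swap s t xs ys)
  then show ?case
    using elt_context[of "[s, t]" "[t, s]" xs ys] elt_swap[of s t] by simp
next
  case (trans u v w)
  then show ?case using shuffle_words[of u v] by simp
qed simp

text \<open>
  The action computes a product in the graph product; hence \<open>act w []\<close> is a reduced word for the
  element represented by \<open>w\<close>.
\<close>

lemma elt_act_syl:
  assumes "s \<in> syllables V G" "w \<in> words"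
  shows "elt (act_syl s w) = elt (s # w)"
proof -
  obtain v g where s: "s = (v, g)" "v \<in> V" "g \<in> carrier (G v)"
    using assms(1) by (auto simp: syllables_def)
  interpret Gv: group "G v" using grp s(2) .
  have prepend: "elt (prepend v h u) = elt ((v, h) # u)" if "h \<in> carrier (G v)" "u \<in> words" for h u
    using that s(2) elt_append[of "[(v, h)]" u] elt_one[OF s(2)]
    by (auto simp: prepend_def syllables_def)
  note hd = head_carrier[OF assms(2) s(2)] and tl = tail_words[OF assms(2), of v]
  have w: "elt w = elt ((v, head v w) # tail v w)"
    using prepend[OF hd tl] elt_shuffle[OF shuffle_front[of v w] assms(2)]
    by (cases "front v w") (auto simp: prepend_def head_def tail_def)
  have "elt (act_syl s w) = elt ((v, g \<otimes>\<^bsub>G v\<^esub> head v w) # tail v w)"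
    using s hd tl by (simp add: act_syl_def prepend)
  also have "\<dots> = elt ([(v, g), (v, head v w)] @ tail v w)"
    using s hd tl elt_merge[of v g "head v w"]
      elt_context[of "[(v, g \<otimes>\<^bsub>G v\<^esub> head v w)]" "[(v, g), (v, head v w)]" "[]" "tail v w"]
    by (simp add: syllables_def)
  also have "\<dots> = elt (s # w)"
    using s hd tl w assms elt_context[of w "(v, head v w) # tail v w" "[s]" "[]"]
    by (simp add: syllables_def)
  finally show ?thesis .
qed

lemma elt_act: "w \<in> words \<Longrightarrow> elt (act w []) = elt w"
proof (induction w)
  case (Cons s w)
  then show ?case
    using elt_act_syl[of s "act w []"] act_words[of w "[]"]
      elt_context[of "act w []" w "[s]" "[]"] by simp
qed simp

text \<open>
  The normal form theorem: words with the same element act in the same way, and a reduced word can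
  be read off from its action on the empty word.
\<close>

theorem reduced_words_shuffle:
  assumes "u \<in> words" "w \<in> words" "reduced u" "reduced w" "elt u = elt w"
  shows "shuffle u w"
  using elt_eq_act[OF assms(1,2,5), of "[]"] assms by (simp add: act_self)

lemma reduced_word_exists:
  assumes "a \<in> carrier H"
  obtains w where "w \<in> words" "reduced w" "elt w = a"
proof -
  obtain f where "f \<in> carrier F" "a = R #>\<^bsub>F\<^esub> f"
    using assms by (auto simp: graph_product_def FactGroup_def RCOSETS_def)
  then obtain w where "w \<in> words" "a = elt w" by (auto simp: free_product_def elt_coset)
  then show thesis using that[of "act w []"] by (simp add: act_words act_reduced elt_act)
qed

text \<open>
  Normalising \<open>w\<close> by the action gives a shuffle of \<open>u\<close>, so no length is lost on the way.
\<close>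

lemma reduced_if_length_le:
  assumes "u \<in> words" "w \<in> words" "reduced u" "elt u = elt w" "length w \<le> length u"
  shows "reduced w"
proof -
  have "shuffle u (act w [])"
    using assms by (intro reduced_words_shuffle) (simp_all add: act_words act_reduced elt_act)
  then have "length (act w []) = length w"
    using shuffle_length[of u "act w []"] length_act[of w] assms(5) by simp
  then show ?thesis using assms(2) by (intro reduced_if_length_act) simp_all
qed

section \<open>Cyclically reduced words\<close>

text \<open>
  Two syllables \<open>s\<^sub>i\<close> and \<open>s\<^sub>j\<close>, \<open>i < j\<close>, of a common vertex violate cyclic reducedness when this vertex
  is adjacent to all vertices before \<open>i\<close> and after \<open>j\<close>, which means that the rotation starting at
  \<open>s\<^sub>j\<close> is not reduced. Asking all rotations to be reduced makes invariance under rotation immediate.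
\<close>

definition cyclically_reduced :: "('v \<times> 'g) list \<Rightarrow> bool" where
  "cyclically_reduced w \<longleftrightarrow> (\<forall>xs ys. w = xs @ ys \<longrightarrow> reduced (ys @ xs))"

lemma cyclically_reducedD: "cyclically_reduced (xs @ ys) \<Longrightarrow> reduced (ys @ xs)"
  by (simp add: cyclically_reduced_def)

lemma reduced_if_cyclically_reduced: "cyclically_reduced w \<Longrightarrow> reduced w"
  using cyclically_reducedD[of "[]" w] by simp

lemma cyclically_reduced_rotate:
  assumes "cyclically_reduced (xs @ ys)"
  shows "cyclically_reduced (ys @ xs)"
  unfolding cyclically_reduced_def
proof (intro allI impI)
  fix u v assume "ys @ xs = u @ v"
  then consider z where "ys = u @ z" "v = z @ xs" | z where "u = ys @ z" "xs = z @ v"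
    by (auto simp: append_eq_append_conv2)
  then show "reduced (v @ u)"
  proof cases
    case 1
    then show ?thesis using assms cyclically_reducedD[of "xs @ u" z] by simp
  next
    case 2
    then show ?thesis using assms cyclically_reducedD[of z "v @ ys"] by simp
  qed
qed

text \<open>
  A rotation of the new word is a shuffle of a rotation of the old one, unless it separates \<open>t\<close> from
  \<open>s\<close> and has the form \<open>s # z @ [t]\<close>. Then \<open>s # z\<close> and \<open>z @ [t]\<close> are subwords of shuffles of
  rotations of the old word, and \<open>s\<close> and \<open>t\<close> cannot merge because their vertices are different.
\<close>

lemma cyclically_reduced_swap:
  assumes "cyclically_reduced (xs @ s # t # ys)" "adj (fst s) (fst t)"
  shows "cyclically_reduced (xs @ t # s # ys)"
  unfolding cyclically_reduced_def
proof (intro allI impI)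
  fix u v assume "xs @ t # s # ys = u @ v"
  then consider z where "xs = u @ z" "v = z @ t # s # ys" | "u = xs @ [t]" "v = s # ys"
    | z where "u = xs @ t # s # z" "ys = z @ v"
    by (auto simp: append_eq_append_conv2 Cons_eq_append_conv)
  then show "reduced (v @ u)"
  proof cases
    case 1
    then have "reduced (z @ s # t # ys @ u)"
      using assms(1) cyclically_reducedD[of u "z @ s # t # ys"] by simp
    then show ?thesis
      using 1 assms(2) reduced_shuffle[OF shuffle.swap[of s t z "ys @ u"]] by simp
  next
    case 2
    let ?z = "ys @ xs"
    have "reduced (s # t # ?z)"
      using assms(1) cyclically_reducedD[of xs "s # t # ys"] by simp
    then have "reduced (s # ?z)"
      using assms(2) reduced_shuffle[OF shuffle.swap[of s t "[]" ?z]] by simp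
    moreover have "reduced (?z @ [s, t])"
      using assms(1) cyclically_reducedD[of "xs @ [s, t]" ys] by simp
    then have "reduced (?z @ [t, s])"
      using assms(2) reduced_shuffle[OF shuffle.swap[of s t ?z "[]"]] by simp
    then have "reduced (?z @ [t])" using reduced_appendD(1)[of "?z @ [t]" "[s]"] by simp
    moreover have "fst s \<noteq> fst t" using assms(2) adj_irrefl by metis
    ultimately have "reduced (s # ?z @ [t])"
      by (auto simp: front_append split: option.splits if_splits)
    then show ?thesis using 2 by simp
  next
    case 3
    then have "reduced (v @ xs @ s # t # z)"
      using assms(1) cyclically_reducedD[of "xs @ s # t # z" v] by simp
    then show ?thesis
      using 3 assms(2) reduced_shuffle[OF shuffle.swap[of s t "v @ xs" z]] by simp
  qed
qed

lemma cyclically_reduced_shuffle: "shuffle u w \<Longrightarrow> cyclically_reduced u \<Longrightarrow> cyclically_reduced w"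
  by (induction rule: shuffle.induct) (auto intro: cyclically_reduced_swap)

lemma cyclically_reduced_replace:
  assumes "fst t = fst t'" "snd t' \<noteq> \<one>\<^bsub>G (fst t')\<^esub>" "cyclically_reduced (t # w)"
  shows "cyclically_reduced (t' # w)"
  unfolding cyclically_reduced_def
proof (intro allI impI)
  fix u v assume "t' # w = u @ v"
  then consider "u = []" "v = t' # w" | z where "u = t' # z" "w = z @ v"
    by (auto simp: Cons_eq_append_conv)
  then show "reduced (v @ u)"
  proof cases
    case 1
    then show ?thesis
      using reduced_replace[OF assms(1,2), of "[]" w] reduced_if_cyclically_reduced[OF assms(3)]
      by simp
  next
    case 2
    then show ?thesis
      using reduced_replace[OF assms(1,2), of v z] assms(3) cyclically_reducedD[of "t # z" v] by simp
  qed
qed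

lemma cyclically_reduced_if_graphically:
  assumes "graphically_cyclically_reduced_word V E G w" "reduced w"
  shows "cyclically_reduced w"
  unfolding cyclically_reduced_def
proof (intro allI impI)
  fix x y assume w: "w = x @ y"
  show "reduced (y @ x)"
  proof (rule reduced_appendI)
    show "reduced x" "reduced y" using reduced_appendD[of x y] assms(2) w by simp_all
    fix v
    show "front v (rev y) = None \<or> front v x = None"
    proof (rule ccontr)
      assume "\<not> ?thesis"
      then have "front v x \<noteq> None" "front v (rev y) \<noteq> None" by auto
      then obtain x1 s x2 y1 t y2
        where x: "x = x1 @ s # x2" "fst s = v" "\<forall>r\<in>set x1. adj (fst r) v"
          and ry: "rev y = y1 @ t # y2" "fst t = v" "\<forall>r\<in>set y1. adj (fst r) v"
        unfolding front_split by blast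
      from ry(1) have y: "y = rev y2 @ t # rev y1" by (simp add: rev_eq_append_conv)
      let ?i = "length x1" and ?j = "length x + length y2"
      have ij: "?i < ?j" "?j < length w" "w ! ?i = s" "w ! ?j = t"
        by (simp_all add: w x(1) y nth_append)
      moreover have "adj (fst (w ! ?i)) (fst (w ! k))" if "k < length w" "k < ?i \<or> ?j < k" for k
      proof -
        have "w ! k \<in> set x1 \<union> set y1"
        proof (cases "k < ?i")
          case False
          then have "w = (x @ rev y2 @ [t]) @ rev y1" "length (x @ rev y2 @ [t]) \<le> k"
            using that by (auto simp: w y)
          then have "w ! k \<in> set (rev y1)"
            using that by (metis add_diff_inverse_nat length_append nat_add_left_cancel_less
                not_less nth_append nth_mem)
          then show ?thesis by simp
        qed (simp add: w x(1) nth_append)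
        then show ?thesis using x ry ij by (auto simp: adj_sym)
      qed
      ultimately show False
        using assms(1) x(2) ry(2) unfolding graphically_cyclically_reduced_word_def by metis
    qed
  qed
qed

section \<open>Conjugacy of cyclically reduced words\<close>

text \<open>
  The moves of which a conjugacy between cyclically reduced words is composed. In the third one the
  syllable is floating, so conjugating it by an element of its vertex-group conjugates the word.
\<close>

inductive conj_move :: "('v \<times> 'g) list \<Rightarrow> ('v \<times> 'g) list \<Rightarrow> bool" where
  swap: "adj (fst s) (fst t) \<Longrightarrow> conj_move (xs @ s # t # ys) (xs @ t # s # ys)"
| rotate: "conj_move (xs @ ys) (ys @ xs)"
| conjugate: "v \<in> V \<Longrightarrow> g \<in> carrier (G v) \<Longrightarrow> h \<in> carrier (G v) \<Longrightarrow> (\<forall>r\<in>set w. adj (fst r) v) \<Longrightarrow>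
    conj_move ((v, g) # w) ((v, h \<otimes>\<^bsub>G v\<^esub> g \<otimes>\<^bsub>G v\<^esub> inv\<^bsub>G v\<^esub> h) # w)"

lemma conj_move_sym: "conj_move u w \<Longrightarrow> conj_move w u"
proof (induction rule: conj_move.induct)
  case (swap s t xs ys)
  then show ?case using conj_move.swap[of t s] by (simp add: adj_sym)
next
  case (rotate xs ys)
  show ?case by (rule conj_move.rotate)
next
  case (conjugate v g h w)
  interpret Gv: group "G v" using grp conjugate(1) .
  let ?k = "h \<otimes>\<^bsub>G v\<^esub> g \<otimes>\<^bsub>G v\<^esub> inv\<^bsub>G v\<^esub> h"
  have "inv\<^bsub>G v\<^esub> h \<otimes>\<^bsub>G v\<^esub> ?k \<otimes>\<^bsub>G v\<^esub> inv\<^bsub>G v\<^esub> (inv\<^bsub>G v\<^esub> h) = g"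
    using conjugate Gv.inv_conj_cancel[of h g] by simp
  then show ?case
    using conjugate conj_move.conjugate[of v ?k "inv\<^bsub>G v\<^esub> h" w] by simp
qed

lemma conj_moves_sym: "conj_move\<^sup>*\<^sup>* u w \<Longrightarrow> conj_move\<^sup>*\<^sup>* w u"
  by (induction rule: rtranclp_induct) (auto intro: converse_rtranclp_into_rtranclp conj_move_sym)

lemma shuffle_conj_moves: "shuffle u w \<Longrightarrow> conj_move\<^sup>*\<^sup>* u w"
  by (induction rule: shuffle.induct) (auto intro: conj_move.swap)

definition inverse_word :: "('v \<times> 'g) list \<Rightarrow> ('v \<times> 'g) list" where
  "inverse_word w = map (\<lambda>(v, g). (v, inv\<^bsub>G v\<^esub> g)) (rev w)"

lemma inverse_word:
  assumes "w \<in> words"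
  shows "inverse_word w \<in> words" and "elt (inverse_word w) = inv\<^bsub>H\<^esub> elt w"
proof -
  have "inverse_word w \<in> words \<and> elt (inverse_word w) = inv\<^bsub>H\<^esub> elt w"
    using assms
  proof (induction w)
    case Nil
    then show ?case by (simp add: inverse_word_def)
  next
    case (Cons s w)
    obtain v g where s: "s = (v, g)" "v \<in> V" "g \<in> carrier (G v)"
      using Cons by (auto simp: syllables_def)
    interpret Gv: group "G v" using grp s(2) .
    have ws: "[s] \<in> words" "[(v, inv\<^bsub>G v\<^esub> g)] \<in> words" using s by (auto simp: syllables_def)
    have "elt [(v, inv\<^bsub>G v\<^esub> g)] \<otimes>\<^bsub>H\<^esub> elt [s] = \<one>\<^bsub>H\<^esub>"
      using s ws elt_append[of "[(v, inv\<^bsub>G v\<^esub> g)]" "[s]"] elt_merge[of v "inv\<^bsub>G v\<^esub> g" g]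
      by (simp add: elt_one)
    then have "elt [(v, inv\<^bsub>G v\<^esub> g)] = inv\<^bsub>H\<^esub> elt [s]"
      using ws by (intro H.inv_equality[symmetric]) simp_all
    moreover have "inverse_word (s # w) = inverse_word w @ [(v, inv\<^bsub>G v\<^esub> g)]"
      by (simp add: inverse_word_def s)
    ultimately show ?case
      using Cons ws elt_append[of "[s]" w] by (simp add: elt_append H.inv_mult_group)
  qed
  then show "inverse_word w \<in> words" "elt (inverse_word w) = inv\<^bsub>H\<^esub> elt w" by auto
qed

lemma reduced_inverse_word:
  assumes "w \<in> words" "reduced w"
  shows "reduced (inverse_word w)"
proof -
  let ?f = "\<lambda>(v, g). (v, inv\<^bsub>G v\<^esub> g)"
  have front: "front v (map ?f x) = None \<longleftrightarrow> front v x = None" for v x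
    by (induction x) auto
  have "reduced (map ?f x)" if "x \<in> words" "reduced x" for x
    using that
  proof (induction x)
    case (Cons s x)
    obtain v g where s: "s = (v, g)" "v \<in> V" "g \<in> carrier (G v)"
      using Cons by (auto simp: syllables_def)
    interpret Gv: group "G v" using grp s(2) .
    show ?case using Cons s front by simp
  qed simp
  then show ?thesis
    using assms reduced_rev[OF assms(2)] unfolding inverse_word_def by (simp add: in_lists_conv_set)
qed

definition initials :: "('v \<times> 'g) list \<Rightarrow> 'v set" where
  "initials w = {v. front v w \<noteq> None}"

lemma finite_initials: "finite (initials w)"
proof (rule finite_subset)
  show "initials w \<subseteq> fst ` set w" using front_in_set by (force simp: initials_def)
qed simp

lemma initials_shuffle: "shuffle u w \<Longrightarrow> initials u = initials w"
  using front_shuffle by (simp add: initials_def)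

lemma elt_cancel:
  assumes "u \<in> words" "w \<in> words" "x \<in> words" "elt (u @ x) = elt (w @ x)"
  shows "elt u = elt w"
  using assms by (simp add: elt_append)

text \<open>
  An induction on the length of \<open>g\<close>, with an inner induction on the number of vertices at which a
  final syllable of \<open>g\<close> meets an initial syllable of \<open>a\<close>. The inner induction assumes that \<open>b\<close> is at most
  as long as \<open>a\<close>; the other case exchanges \<open>a\<close> and \<open>b\<close> and inverts \<open>g\<close>, which keeps the length of \<open>g\<close>.
\<close>

lemma conj_moves_if_conjugate:
  assumes "g \<in> words" "reduced g" "a \<in> words" "cyclically_reduced a"
    "b \<in> words" "cyclically_reduced b" "elt (g @ a) = elt (b @ g)"
  shows "conj_move\<^sup>*\<^sup>* a b"
  using assms
proof (induction "length g" arbitrary: g a b rule: less_induct)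
  case (less g0)
  note outer = less.hyps
  have main: "conj_move\<^sup>*\<^sup>* a b"
    if "length g = length g0" "length b \<le> length a" "g \<in> words" "reduced g" "a \<in> words"
      "cyclically_reduced a" "b \<in> words" "cyclically_reduced b" "elt (g @ a) = elt (b @ g)" for g a b
    using that
  proof (induction "card (initials (rev g) \<inter> initials a)" arbitrary: g a b rule: less_induct)
    case (less g a b)
    note prems = less.prems
    have red: "reduced a" "reduced b"
      using prems by (auto intro: reduced_if_cyclically_reduced)
    have shorter: "conj_move\<^sup>*\<^sup>* a' b"
      if "length h < length g" "h \<in> words" "reduced h" "a' \<in> words" "cyclically_reduced a'"
        "elt (h @ a') = elt (b @ h)" for h a'
      using prems that by (intro outer[of h a' b]) simp_all
    show ?case
    proof (cases "initials (rev g) \<inter> initials a = {}")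
      case False
      then obtain v s t where fr: "front v (rev g) = Some s" "front v a = Some t"
        by (auto simp: initials_def)
      obtain h where h: "shuffle g (h @ [(v, s)])" using shuffle_back[OF fr(1)] by blast
      obtain c where c: "shuffle a ((v, t) # c)" using shuffle_front[OF fr(2)] by blast
      have hw: "h \<in> words" and cw: "c \<in> words" and v: "v \<in> V"
        and s: "s \<in> carrier (G v)" and t: "t \<in> carrier (G v)"
        using prems shuffle_words[OF h] shuffle_words[OF c] by (auto simp: syllables_def)
      interpret Gv: group "G v" using grp v .
      have sy: "(v, x) \<in> syllables V G \<longleftrightarrow> x \<in> carrier (G v)" for x
        using v by (simp add: syllables_def)
      have redh: "reduced (h @ [(v, s)])" "reduced h"
        using prems reduced_shuffle[OF h] reduced_appendD(1)[of h "[(v, s)]"] by simp_all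
      have cyc: "cyclically_reduced ((v, t) # c)"
        using prems cyclically_reduced_shuffle[OF c] by simp
      have len: "length g = Suc (length h)" "length a = Suc (length c)"
        using shuffle_length[OF h] shuffle_length[OF c] by simp_all
      have g: "elt g = elt (h @ [(v, s)])" and a: "elt a = elt ((v, t) # c)"
        using elt_shuffle[OF h] elt_shuffle[OF c] prems by simp_all
      have eq: "elt (h @ [(v, s)] @ (v, t) # c) = elt (b @ h @ [(v, s)])"
      proof -
        have "elt (h @ [(v, s)] @ (v, t) # c) = elt g \<otimes>\<^bsub>H\<^esub> elt a"
          using elt_append[of "h @ [(v, s)]" "(v, t) # c"] g a hw cw s t sy by simp
        also have "\<dots> = elt b \<otimes>\<^bsub>H\<^esub> elt g" using prems by (simp add: elt_append)
        also have "\<dots> = elt (b @ h @ [(v, s)])"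
          using elt_append[of b "h @ [(v, s)]"] g prems hw s sy by simp
        finally show ?thesis .
      qed
      have merged: "elt (h @ (v, s \<otimes>\<^bsub>G v\<^esub> t) # x) = elt (h @ [(v, s)] @ (v, t) # x)" if "x \<in> words" for x
        using that hw s t sy elt_merge[OF v s t]
          elt_context[of "[(v, s \<otimes>\<^bsub>G v\<^esub> t)]" "[(v, s), (v, t)]" h x] by simp
      have moves: "conj_move\<^sup>*\<^sup>* a ((v, t) # c)" using shuffle_conj_moves[OF c] .
      show ?thesis
      proof (cases "\<forall>r\<in>set c. adj (fst r) v")
        case True
        \<comment> \<open>\<open>t\<close> is floating, and \<open>s\<close> commutes with \<open>c\<close>: \<open>s t c = (s t s\<inverse>) c s\<close>\<close>
        let ?t = "s \<otimes>\<^bsub>G v\<^esub> t \<otimes>\<^bsub>G v\<^esub> inv\<^bsub>G v\<^esub> s"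
        have "conj_move ((v, t) # c) ((v, ?t) # c)"
          using v t s True by (rule conj_move.conjugate)
        moreover have "conj_move\<^sup>*\<^sup>* ((v, ?t) # c) b"
        proof (rule shorter)
          have "t \<noteq> \<one>\<^bsub>G v\<^esub>" using reduced_if_cyclically_reduced[OF cyc] by simp
          then have "?t \<noteq> \<one>\<^bsub>G v\<^esub>"
            using s t Gv.inv_conj_cancel[of s t] by auto
          then show "cyclically_reduced ((v, ?t) # c)"
            using cyclically_reduced_replace[OF _ _ cyc, of "(v, ?t)"] by simp
          have "shuffle ((v, s) # c) (c @ [(v, s)])" using True by (intro shuffle_past) simp
          then have "elt ((v, s) # c) = elt (c @ [(v, s)])" using elt_shuffle cw s sy by simp
          then have "elt (h @ (v, ?t) # c @ [(v, s)]) = elt (h @ (v, ?t) # (v, s) # c)"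
            using elt_context[of "(v, s) # c" "c @ [(v, s)]" "h @ [(v, ?t)]" "[]"] hw cw s t sy by simp
          also have "\<dots> = elt (h @ (v, ?t \<otimes>\<^bsub>G v\<^esub> s) # c)"
            using elt_context[of "[(v, ?t), (v, s)]" "[(v, ?t \<otimes>\<^bsub>G v\<^esub> s)]" h c]
              elt_merge[of v ?t s] v hw cw s t sy by simp
          also have "?t \<otimes>\<^bsub>G v\<^esub> s = s \<otimes>\<^bsub>G v\<^esub> t" using s t by (simp add: Gv.m_assoc)
          also have "elt (h @ (v, s \<otimes>\<^bsub>G v\<^esub> t) # c) = elt (b @ h @ [(v, s)])"
            using merged[OF cw] eq by simp
          finally show "elt (h @ (v, ?t) # c) = elt (b @ h)"
            using elt_cancel[of "h @ (v, ?t) # c" "b @ h" "[(v, s)]"] prems hw cw s t sy by simp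
        qed (use hw cw s t sy redh len in auto)
        ultimately show ?thesis using moves by (simp add: converse_rtranclp_into_rtranclp)
      next
        case False
        \<comment> \<open>\<open>t\<close> is not floating: multiply \<open>g a = b g\<close> by \<open>t\<close> on the right and regroup \<open>g t = h (s t)\<close>\<close>
        let ?a = "c @ [(v, t)]"
        have rot: "conj_move ((v, t) # c) ?a" using conj_move.rotate[of "[(v, t)]" c] by simp
        have cyc': "cyclically_reduced ?a" using cyclically_reduced_rotate[of "[(v, t)]" c] cyc by simp
        have aw: "?a \<in> words" using cw t sy by simp
        have eq': "elt (h @ (v, s \<otimes>\<^bsub>G v\<^esub> t) # ?a) = elt (b @ h @ [(v, s \<otimes>\<^bsub>G v\<^esub> t)])"
        proof -
          have "elt (h @ (v, s \<otimes>\<^bsub>G v\<^esub> t) # ?a) = elt ((h @ [(v, s)] @ (v, t) # c) @ [(v, t)])"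
            using merged[OF aw] by simp
          also have "\<dots> = elt ((b @ h @ [(v, s)]) @ [(v, t)])"
            using eq elt_context[of "h @ [(v, s)] @ (v, t) # c" "b @ h @ [(v, s)]" "[]" "[(v, t)]"]
              prems hw cw s t sy by simp
          also have "\<dots> = elt (b @ h @ [(v, s \<otimes>\<^bsub>G v\<^esub> t)])"
            using merged[of "[]"] elt_context[of "h @ [(v, s), (v, t)]" "h @ [(v, s \<otimes>\<^bsub>G v\<^esub> t)]" b "[]"]
              prems hw s t sy by simp
          finally show ?thesis .
        qed
        have "conj_move\<^sup>*\<^sup>* ?a b"
        proof (cases "s \<otimes>\<^bsub>G v\<^esub> t = \<one>\<^bsub>G v\<^esub>")
          case True
          have drop: "elt (h @ (v, \<one>\<^bsub>G v\<^esub>) # x) = elt (h @ x)" if "x \<in> words" for x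
            using elt_context[of "[(v, \<one>\<^bsub>G v\<^esub>)]" "[]" h x] elt_one[OF v] hw that sy by simp
          have "elt (h @ ?a) = elt (b @ h)"
            using eq' True drop[OF aw] drop[of "[]"] prems hw cw t sy by (simp add: elt_append)
          then show ?thesis using shorter[of h ?a] len hw redh aw cyc' by simp
        next
          case False': False
          let ?g = "h @ [(v, s \<otimes>\<^bsub>G v\<^esub> t)]"
          have red': "reduced ?g" using False' reduced_replace[OF _ _ redh(1), of "(v, s \<otimes>\<^bsub>G v\<^esub> t)"] by simp
          have ig: "initials (rev ?g) = initials (rev g)"
            using initials_shuffle[OF shuffle_rev[OF h]] by (auto simp: initials_def)
          have ia: "initials a = initials ((v, t) # c)" using initials_shuffle[OF c] .
          have "front v c = None" using reduced_if_cyclically_reduced[OF cyc] by simp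
          then have v_notin: "v \<notin> initials ?a"
            using False by (simp add: initials_def front_append)
          \<comment> \<open>Final vertices of \<open>g\<close> other than \<open>v\<close> are adjacent to \<open>v\<close>, so moving \<open>t\<close> away cannot expose a
            new initial syllable of \<open>a\<close> at one of them.\<close>
          have "initials (rev ?g) \<inter> initials ?a \<subseteq> initials (rev g) \<inter> initials a"
          proof
            fix u assume u: "u \<in> initials (rev ?g) \<inter> initials ?a"
            then have "u \<noteq> v" using v_notin by blast
            then have "adj v u" using u by (auto simp: initials_def split: if_splits)
            moreover have "front u c \<noteq> None"
              using u \<open>u \<noteq> v\<close> by (auto simp: initials_def front_append split: option.splits if_splits)
            ultimately have "u \<in> initials ((v, t) # c)" by (simp add: initials_def)
            then show "u \<in> initials (rev g) \<inter> initials a" using u ig ia by simp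
          qed
          moreover have "v \<in> initials (rev g) \<inter> initials a" using fr by (simp add: initials_def)
          ultimately have "initials (rev ?g) \<inter> initials ?a \<subset> initials (rev g) \<inter> initials a"
            using v_notin by blast
          then have "card (initials (rev ?g) \<inter> initials ?a) < card (initials (rev g) \<inter> initials a)"
            by (intro psubset_card_mono) (simp add: finite_initials)
          then show ?thesis
            using less.hyps[of ?g ?a b] prems len red' aw cyc' eq' hw s t sy by simp
        qed
        then show ?thesis using moves rot by (simp add: converse_rtranclp_into_rtranclp)
      qed
    next
      case True
      show ?thesis
      proof (cases g rule: rev_exhaust)
        case Nil
        then have "shuffle a b" using prems red by (intro reduced_words_shuffle) simp_all
        then show ?thesis by (rule shuffle_conj_moves)
      next
        case (snoc h x)
        obtain v s where x: "x = (v, s)" by force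
        have hw: "h \<in> words" "(v, s) \<in> syllables V G" and redh: "reduced h"
          using prems snoc x reduced_appendD(1)[of h "[x]"] by simp_all
        have inw: "g @ a \<in> words" "b @ g \<in> words" using prems by simp_all
        have disj: "front u (rev g) = None \<or> front u a = None" for u
          using True by (auto simp: initials_def)
        have rga: "reduced (g @ a)" using \<open>reduced g\<close> red(1) disj by (rule reduced_appendI)
        have "length (b @ g) \<le> length (g @ a)" using \<open>length b \<le> length a\<close> by simp
        with inw rga \<open>elt (g @ a) = elt (b @ g)\<close> have "reduced (b @ g)"
          by (rule reduced_if_length_le)
        then have sh: "shuffle (g @ a) (b @ g)"
          using inw rga \<open>elt (g @ a) = elt (b @ g)\<close> by (intro reduced_words_shuffle)
        \<comment> \<open>The last syllable of \<open>b g\<close> is \<open>(v, s)\<close>, so it is a final syllable of the shuffle \<open>g a\<close>.\<close>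
        have fr: "front v (rev a @ rev g) = Some s"
          using front_shuffle[OF shuffle_rev[OF sh], of v] snoc x by simp
        have eq: "elt (h @ [(v, s)] @ a) = elt (b @ h @ [(v, s)])" using prems snoc x by simp
        show ?thesis
        proof (cases "front v (rev a)")
          case (Some s')
          then have "front v (rev a) = Some s" using fr by (simp add: front_append)
          then obtain c where c: "shuffle a (c @ [(v, s)])" using shuffle_back by blast
          let ?a = "(v, s) # c"
          have cw: "c \<in> words" using prems shuffle_words[OF c] by simp
          have "conj_move\<^sup>*\<^sup>* a (c @ [(v, s)])" using shuffle_conj_moves[OF c] .
          also have "conj_move (c @ [(v, s)]) ?a" using conj_move.rotate[of c "[(v, s)]"] by simp
          also (rtranclp.rtrancl_into_rtrancl) have "conj_move\<^sup>*\<^sup>* ?a b"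
          proof (rule shorter)
            show "cyclically_reduced ?a"
              using cyclically_reduced_rotate[of c "[(v, s)]"] cyclically_reduced_shuffle[OF c] prems
              by simp
            have "elt (h @ [(v, s)] @ a) = elt ((h @ [(v, s)]) @ c @ [(v, s)])"
              using elt_shuffle[OF c] elt_context[of a "c @ [(v, s)]" "h @ [(v, s)]" "[]"] prems hw cw
              by simp
            then show "elt (h @ ?a) = elt (b @ h)"
              using eq elt_cancel[of "h @ ?a" "b @ h" "[(v, s)]"] prems hw cw by simp
          qed (use snoc hw cw redh in auto)
          finally show ?thesis .
        next
          case None
          then have "\<forall>r\<in>set a. adj (fst r) v"
            using fr by (auto simp: front_append split: if_splits)
          then have "shuffle ((v, s) # a) (a @ [(v, s)])" by (intro shuffle_past) simp
          then have "elt ((v, s) # a) = elt (a @ [(v, s)])" using elt_shuffle prems hw by simp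
          then have "elt (h @ [(v, s)] @ a) = elt (h @ a @ [(v, s)])"
            using elt_context[of "(v, s) # a" "a @ [(v, s)]" h "[]"] prems hw by simp
          then have "elt (h @ a) = elt (b @ h)"
            using eq elt_cancel[of "h @ a" "b @ h" "[(v, s)]"] prems hw by simp
          then show ?thesis using shorter[of h a] snoc hw redh prems by simp
        qed
      qed
    qed
  qed
  show ?case
  proof (cases "length b \<le> length a")
    case True
    then show ?thesis using main[of g0 b a] less.prems by simp
  next
    case False
    have "elt (inverse_word g0 @ b) = elt (a @ inverse_word g0)"
    proof -
      let ?x = "elt g0"
      have x: "?x \<in> carrier H" "elt a \<in> carrier H" "elt b \<in> carrier H" using less.prems by simp_all
      have "?x \<otimes>\<^bsub>H\<^esub> elt a = elt b \<otimes>\<^bsub>H\<^esub> ?x" using less.prems by (simp add: elt_append)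
      then have "elt b = ?x \<otimes>\<^bsub>H\<^esub> elt a \<otimes>\<^bsub>H\<^esub> inv\<^bsub>H\<^esub> ?x" using x by (simp add: H.m_assoc)
      then have "elt a = inv\<^bsub>H\<^esub> ?x \<otimes>\<^bsub>H\<^esub> elt b \<otimes>\<^bsub>H\<^esub> ?x" using H.inv_conj_cancel[OF x(1,2)] by simp
      then have "inv\<^bsub>H\<^esub> ?x \<otimes>\<^bsub>H\<^esub> elt b = elt a \<otimes>\<^bsub>H\<^esub> inv\<^bsub>H\<^esub> ?x" using x by (simp add: H.m_assoc)
      then show ?thesis using less.prems by (simp add: elt_append inverse_word)
    qed
    moreover have "length (inverse_word g0) = length g0" by (simp add: inverse_word_def)
    ultimately have "conj_move\<^sup>*\<^sup>* b a"
      using main[of "inverse_word g0" a b] False less.prems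
      by (simp add: inverse_word reduced_inverse_word)
    then show ?thesis by (rule conj_moves_sym)
  qed
qed

section \<open>Separating the floating syllables\<close>

text \<open>
  For the multiset \<open>M\<close> of the vertices of a word, \<open>isolated M v\<close> says that a syllable of \<open>v\<close> in it is
  floating. In this form the property depends on data that the moves preserve.
\<close>

definition isolated :: "'v multiset \<Rightarrow> 'v \<Rightarrow> bool" where
  "isolated M v \<longleftrightarrow> (\<forall>u\<in>#M - {#v#}. adj u v)"

abbreviation vertices :: "('v \<times> 'g) list \<Rightarrow> 'v multiset" where
  "vertices w \<equiv> mset (map fst w)"

abbreviation pairwise_conjugate :: "('v \<times> 'g) list \<Rightarrow> ('v \<times> 'g) list \<Rightarrow> bool" where
  "pairwise_conjugate \<equiv>
    list_all2 (\<lambda>p q. fst p = fst q \<and> conjugate_in (G (fst p)) (snd p) (snd q))"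

lemma isolated_adj: "isolated M v \<Longrightarrow> u \<in># M \<Longrightarrow> u \<noteq> v \<Longrightarrow> adj u v"
  by (simp add: isolated_def in_diff_count)

lemma isolated_submultiset:
  assumes "isolated M v" "N \<subseteq># M"
  shows "isolated N v"
proof -
  have "N - {#v#} \<subseteq># M - {#v#}"
    using mset_subset_eq_count[OF assms(2)] by (intro mset_subset_eqI) (simp add: diff_le_mono)
  then show ?thesis using assms(1) by (auto simp: isolated_def dest: mset_subset_eqD)
qed

lemma pairwise_conjugate_refl:
  assumes "w \<in> words"
  shows "pairwise_conjugate w w"
proof (rule list.rel_refl_strong)
  fix s assume "s \<in> set w"
  then have "fst s \<in> V" "snd s \<in> carrier (G (fst s))"
    using assms words_syllableD[of w "fst s" "snd s"] by simp_all
  then show "fst s = fst s \<and> conjugate_in (G (fst s)) (snd s) (snd s)"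
    using conjugate_in_refl[OF grp[of "fst s"], of "snd s"] by simp
qed

text \<open>
  When the floating syllables are deleted, a swap becomes a swap or disappears, a rotation remains a
  rotation, and conjugations of floating syllables disappear. The floating syllables of \<open>b\<close> are
  listed by \<open>qs\<close> in the order of the corresponding ones of \<open>a\<close>.
\<close>

lemma conj_moves_nonfloating:
  assumes "conj_move\<^sup>*\<^sup>* a b" "a \<in> words"
  defines "P \<equiv> \<lambda>s. isolated (vertices a) (fst s)"
  shows "vertices b = vertices a \<and> b \<in> words \<and>
    (word_move E)\<^sup>*\<^sup>* (filter (\<lambda>s. \<not> P s) a) (filter (\<lambda>s. \<not> P s) b) \<and>
    (\<exists>qs. mset qs = mset (filter P b) \<and> pairwise_conjugate (filter P a) qs)"
  using assms(1)
proof (induction rule: rtranclp_induct)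
  case base
  have "filter P a \<in> words" using assms(2) by (simp add: in_lists_conv_set)
  then show ?case using assms(2) pairwise_conjugate_refl by blast
next
  case (step b b')
  then obtain qs where b: "vertices b = vertices a" "b \<in> words"
    "(word_move E)\<^sup>*\<^sup>* (filter (\<lambda>s. \<not> P s) a) (filter (\<lambda>s. \<not> P s) b)"
    and qs: "mset qs = mset (filter P b)" "pairwise_conjugate (filter P a) qs"
    by blast
  from step.hyps(2) b qs show ?case
  proof (cases rule: conj_move.cases)
    case (swap s t xs ys)
    have "(word_move E)\<^sup>*\<^sup>* (filter (\<lambda>s. \<not> P s) b) (filter (\<lambda>s. \<not> P s) b')"
      using swap word_move.swap[of s t E "filter (\<lambda>s. \<not> P s) xs" "filter (\<lambda>s. \<not> P s) ys"] by auto
    then have "(word_move E)\<^sup>*\<^sup>* (filter (\<lambda>s. \<not> P s) a) (filter (\<lambda>s. \<not> P s) b')"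
      using b(3) by (rule rtranclp_trans[rotated])
    moreover have "mset (filter P b') = mset (filter P b)" using swap by simp
    moreover have "vertices b' = vertices b" unfolding swap(1,2) by simp
    moreover have "b' \<in> words" using swap b(2) by simp
    ultimately show ?thesis using b(1) qs by auto
  next
    case (rotate xs ys)
    have "word_move E (filter (\<lambda>s. \<not> P s) b) (filter (\<lambda>s. \<not> P s) b')"
      using rotate word_move.rotate[of E "filter (\<lambda>s. \<not> P s) xs" "filter (\<lambda>s. \<not> P s) ys"] by simp
    moreover have "mset (filter P b') = mset (filter P b)" using rotate by simp
    moreover have "vertices b' = vertices b" unfolding rotate by simp
    moreover have "b' \<in> words" using rotate b(2) by simp
    ultimately show ?thesis using b qs by (auto elim: rtranclp.rtrancl_into_rtrancl)
  next
    case (conjugate v g h w)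
    interpret Gv: group "G v" using grp conjugate(3) .
    let ?k = "h \<otimes>\<^bsub>G v\<^esub> g \<otimes>\<^bsub>G v\<^esub> inv\<^bsub>G v\<^esub> h"
    have "vertices a = add_mset v (vertices w)" using b conjugate by simp
    then have P: "P (v, x)" for x using conjugate by (auto simp: P_def isolated_def)
    then have "(v, g) \<in> set qs"
      using qs(1) conjugate by (metis filter.simps(2) list.set_intros(1) set_mset_mset)
    then obtain i where i: "i < length qs" "qs ! i = (v, g)" by (auto simp: in_set_conv_nth)
    have "mset (qs[i := (v, ?k)]) = mset (filter P b')"
      using i qs(1) conjugate P by (simp add: mset_update)
    moreover have "pairwise_conjugate (filter P a) (qs[i := (v, ?k)])"
      unfolding list_all2_conv_all_nth
    proof (intro conjI allI impI)
      show "length (filter P a) = length (qs[i := (v, ?k)])"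
        using qs(2) by (simp add: list_all2_lengthD)
      fix j assume j: "j < length (filter P a)"
      let ?p = "filter P a ! j"
      have pq: "fst ?p = fst (qs ! j)" "conjugate_in (G (fst ?p)) (snd ?p) (snd (qs ! j))"
        using list_all2_nthD[OF qs(2) j] by blast+
      have "?p \<in> set a" using nth_mem[OF j] by simp
      then have p: "snd ?p \<in> carrier (G (fst ?p))"
        using assms(2) words_syllableD[of a "fst ?p" "snd ?p"] by simp
      have "conjugate_in (G v) g ?k"
        using conjugate unfolding conjugate_in_def by blast
      then have "i = j \<Longrightarrow> conjugate_in (G (fst ?p)) (snd ?p) ?k"
        using pq p i conjugate_in_trans[OF Gv.group_axioms, of "snd ?p" g ?k] by simp
      then show "fst ?p = fst (qs[i := (v, ?k)] ! j)"
        "conjugate_in (G (fst ?p)) (snd ?p) (snd (qs[i := (v, ?k)] ! j))"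
        using pq i by (auto simp: nth_list_update)
    qed
    moreover have "vertices b' = vertices a" "b' \<in> words"
      using b conjugate by (auto simp: syllables_def)
    moreover have "filter (\<lambda>s. \<not> P s) b' = filter (\<lambda>s. \<not> P s) b" using conjugate P by simp
    ultimately show ?thesis using b by auto
  qed
qed

lemma shuffle_filter:
  assumes "\<And>s r. s \<in> set w \<Longrightarrow> r \<in> set w \<Longrightarrow> P s \<Longrightarrow> \<not> P r \<Longrightarrow> adj (fst r) (fst s)"
  shows "shuffle w (filter (\<lambda>s. \<not> P s) w @ filter P w)"
  using assms
proof (induction w)
  case (Cons s w)
  let ?N = "filter (\<lambda>s. \<not> P s) w" and ?Q = "filter P w"
  have IH: "shuffle (s # w) (s # ?N @ ?Q)" using Cons by (intro shuffle_Cons) simp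
  show ?case
  proof (cases "P s")
    case True
    have "shuffle (s # ?N) (?N @ [s])" using Cons.prems True by (intro shuffle_past) simp
    then have "shuffle (s # ?N @ ?Q) (?N @ s # ?Q)"
      using shuffle_context[of "s # ?N" "?N @ [s]" "[]" ?Q] by simp
    with IH have "shuffle (s # w) (?N @ s # ?Q)" by (rule shuffle.trans)
    then show ?thesis using True by simp
  qed (use IH in simp)
qed simp

lemma shuffle_isolated:
  assumes "mset ps = mset qs" "\<And>p. p \<in> set ps \<Longrightarrow> isolated (vertices ps) (fst p)"
  shows "shuffle ps qs"
  using assms
proof (induction ps arbitrary: qs)
  case (Cons p ps)
  then have "p \<in> set qs" by (metis list.set_intros(1) set_mset_mset)
  then obtain q1 q2 where qs: "qs = q1 @ p # q2" by (auto simp: in_set_conv_decomp)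
  then have ms: "mset ps = mset (q1 @ q2)" using Cons.prems(1) by simp
  have "isolated (vertices ps) (fst r)" if "r \<in> set ps" for r
    using isolated_submultiset[OF Cons.prems(2), of r "vertices ps"] that by simp
  then have "shuffle (p # ps) (p # q1 @ q2)" using Cons.IH ms by (intro shuffle_Cons) simp
  moreover have "shuffle (p # q1) (q1 @ [p])"
  proof (rule shuffle_past)
    fix r assume "r \<in> set q1"
    then have "r \<in> set ps" using ms by (metis UnI1 set_append set_mset_mset)
    then show "adj (fst r) (fst p)" using Cons.prems(2)[of p] by (auto simp: isolated_def)
  qed
  then have "shuffle (p # q1 @ q2) qs"
    using shuffle_context[of "p # q1" "q1 @ [p]" "[]" q2] qs by simp
  ultimately show ?case by (rule shuffle.trans)
qed simp

lemma shuffle_isolated_last: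
  fixes w qs
  defines "P \<equiv> \<lambda>s. isolated (vertices w) (fst s)"
  assumes "mset qs = mset (filter P w)"
  shows "shuffle w (filter (\<lambda>s. \<not> P s) w @ qs)"
proof -
  let ?N = "filter (\<lambda>s. \<not> P s) w"
  have "shuffle w (?N @ filter P w)"
  proof (rule shuffle_filter)
    fix s r assume *: "s \<in> set w" "r \<in> set w" "P s" "\<not> P r"
    then have "fst r \<noteq> fst s" by (auto simp: P_def)
    then show "adj (fst r) (fst s)" using * by (auto simp: P_def intro: isolated_adj)
  qed
  moreover have "shuffle (filter P w) qs"
  proof (rule shuffle_isolated)
    show "mset (filter P w) = mset qs" using assms(2) by simp
    fix p assume "p \<in> set (filter P w)"
    then have "isolated (vertices w) (fst p)" by (simp add: P_def)
    moreover have "vertices (filter P w) \<subseteq># vertices w"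
      by (simp add: image_mset_subseteq_mono)
    ultimately show "isolated (vertices (filter P w)) (fst p)" by (rule isolated_submultiset)
  qed
  then have "shuffle (?N @ filter P w) (?N @ qs)" using shuffle_context[of _ _ ?N "[]"] by simp
  ultimately show ?thesis by (rule shuffle.trans)
qed

lemma floating_if_isolated:
  assumes "i < length w" "isolated (vertices w) (fst (w ! i))"
  shows "floating E w i"
  unfolding floating_def
proof (intro conjI allI impI)
  fix k assume k: "k < length w" "k \<noteq> i"
  have "vertices w = vertices (take i w @ w ! i # drop (Suc i) w)"
    using id_take_nth_drop[OF assms(1)] by simp
  then have "vertices w - {#fst (w ! i)#} = vertices (take i w) + vertices (drop (Suc i) w)"
    by simp
  moreover have "w ! k \<in> set (take i w) \<union> set (drop (Suc i) w)"
  proof (cases "k < i")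
    case True
    then show ?thesis using k by (auto simp: in_set_conv_nth)
  next
    case False
    then have "w ! k = drop (Suc i) w ! (k - Suc i)" "k - Suc i < length (drop (Suc i) w)"
      using k by auto
    then show ?thesis by (metis UnI2 nth_mem)
  qed
  ultimately have "adj (fst (w ! k)) (fst (w ! i))"
    using assms(2) by (auto simp: isolated_def)
  then show "adj (fst (w ! i)) (fst (w ! k))" by (simp add: adj_sym)
qed (rule assms(1))

section \<open>Moves preserve the conjugacy class\<close>

text \<open>
  A rotation of \<open>us @ vs\<close> is the conjugation by the inverse of \<open>us\<close>; it leaves \<open>ps\<close> in place because
  \<open>us\<close> commutes with \<open>ps\<close>.
\<close>

lemma word_moves_conjugate:
  assumes "(word_move E)\<^sup>*\<^sup>* xs ys" "xs @ ps \<in> words"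
    "\<And>p x. p \<in> set ps \<Longrightarrow> x \<in> set xs \<Longrightarrow> adj (fst p) (fst x)"
  shows "mset ys = mset xs \<and> conjugate_in H (elt (xs @ ps)) (elt (ys @ ps))"
  using assms(1)
proof (induction rule: rtranclp_induct)
  case base
  show ?case using assms(2) conjugate_in_refl[OF H.group_axioms] by simp
next
  case (step ys ys')
  then have ms: "mset ys = mset xs" by simp
  then have set_ys: "set ys = set xs" by (rule mset_eq_setD)
  then have ysw: "ys \<in> words" "ps \<in> words"
    using assms(2) by (simp_all add: in_lists_conv_set)
  have pcomm: "adj (fst p) (fst y)" if "p \<in> set ps" "y \<in> set ys" for p y
    using assms(3) that set_ys by simp
  have "mset ys' = mset ys \<and> conjugate_in H (elt (ys @ ps)) (elt (ys' @ ps))"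
    using step.hyps(2)
  proof cases
    case (swap s t us vs)
    then have "shuffle (ys @ ps) (ys' @ ps)"
      using shuffle.swap[of s t us "vs @ ps"] by simp
    then have "elt (ys @ ps) = elt (ys' @ ps)" using elt_shuffle ysw by simp
    then show ?thesis using swap ysw conjugate_in_refl[OF H.group_axioms, of "elt (ys @ ps)"] by simp
  next
    case (rotate us vs)
    have w: "us \<in> words" "vs \<in> words" using rotate ysw by simp_all
    have us: "elt (us @ ps) = elt (ps @ us)"
    proof -
      have "shuffle (us @ qs) (qs @ us)" if "set qs \<subseteq> set ps" for qs
        using that
      proof (induction qs)
        case (Cons q qs)
        have "shuffle (q # us) (us @ [q])"
        proof (rule shuffle_past)
          fix r assume "r \<in> set us"
          then have "adj (fst q) (fst r)" using Cons.prems rotate by (intro pcomm) simp_all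
          then show "adj (fst r) (fst q)" by (simp add: adj_sym)
        qed
        then have "shuffle (us @ q # qs) (q # us @ qs)"
          using shuffle_sym shuffle_context[of "us @ [q]" "q # us" "[]" qs] by simp
        moreover have "shuffle (q # us @ qs) (q # qs @ us)"
          using Cons by (intro shuffle_Cons) simp
        ultimately show ?case using shuffle.trans by simp
      qed simp
      then show ?thesis using elt_shuffle w ysw by simp
    qed
    let ?u = "elt us" and ?v = "elt vs" and ?p = "elt ps"
    have c: "?u \<in> carrier H" "?v \<in> carrier H" "?p \<in> carrier H" using w ysw by simp_all
    have "elt (ys' @ ps) = ?v \<otimes>\<^bsub>H\<^esub> (?p \<otimes>\<^bsub>H\<^esub> ?u)"
      using us rotate w ysw by (simp add: elt_append H.m_assoc)
    also have "\<dots> = inv\<^bsub>H\<^esub> ?u \<otimes>\<^bsub>H\<^esub> (?u \<otimes>\<^bsub>H\<^esub> ?v \<otimes>\<^bsub>H\<^esub> ?p) \<otimes>\<^bsub>H\<^esub> inv\<^bsub>H\<^esub> (inv\<^bsub>H\<^esub> ?u)"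
    proof -
      have "inv\<^bsub>H\<^esub> ?u \<otimes>\<^bsub>H\<^esub> (?u \<otimes>\<^bsub>H\<^esub> (?v \<otimes>\<^bsub>H\<^esub> ?p)) = ?v \<otimes>\<^bsub>H\<^esub> ?p"
        using c by (simp flip: H.m_assoc)
      then show ?thesis using c by (simp add: H.m_assoc)
    qed
    also have "?u \<otimes>\<^bsub>H\<^esub> ?v \<otimes>\<^bsub>H\<^esub> ?p = elt (ys @ ps)" using rotate w ysw by (simp add: elt_append H.m_assoc)
    finally have "conjugate_in H (elt (ys @ ps)) (elt (ys' @ ps))"
      unfolding conjugate_in_def using c by blast
    then show ?thesis using rotate by simp
  qed
  moreover have "elt (xs @ ps) \<in> carrier H" using assms(2) by simp
  ultimately show ?case
    using step.IH conjugate_in_trans[OF H.group_axioms] by metis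
qed

text \<open>
  The syllables \<open>p\<close> are conjugated one after the other: a conjugating element of the vertex-group of \<open>p\<close>
  commutes with all other syllables. The word \<open>zs\<close> collects those already treated.
\<close>

lemma pairwise_conjugate_elt:
  assumes "pairwise_conjugate ps qs" "zs @ ps \<in> words"
    "sorted_wrt (\<lambda>p q. adj (fst p) (fst q)) ps"
    "\<And>p z. p \<in> set ps \<Longrightarrow> z \<in> set zs \<Longrightarrow> adj (fst p) (fst z)"
  shows "conjugate_in H (elt (zs @ ps)) (elt (zs @ qs))"
  using assms
proof (induction ps qs arbitrary: zs rule: list_all2_induct)
  case Nil
  then show ?case using conjugate_in_refl[OF H.group_axioms] by simp
next
  case (Cons p ps q qs)
  obtain v g where p: "p = (v, g)" "v \<in> V" "g \<in> carrier (G v)"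
    using Cons.prems by (auto simp: syllables_def)
  interpret Gv: group "G v" using grp p(2) .
  have "fst q = v" "conjugate_in (G v) g (snd q)" using Cons.hyps(1) by (auto simp: p(1))
  then obtain h where h: "h \<in> carrier (G v)" and q: "q = (v, h \<otimes>\<^bsub>G v\<^esub> g \<otimes>\<^bsub>G v\<^esub> inv\<^bsub>G v\<^esub> h)"
    unfolding conjugate_in_def by (metis prod.collapse)
  have w: "zs \<in> words" "ps \<in> words" "p \<in> syllables V G" "q \<in> syllables V G" "(v, h) \<in> syllables V G"
    using Cons.prems h q p by (auto simp: syllables_def)
  have q': "fst q = fst p" using p q by simp
  let ?h = "[(v, h)]"
  have "elt (zs @ q # ps) \<otimes>\<^bsub>H\<^esub> elt ?h = elt ?h \<otimes>\<^bsub>H\<^esub> elt (zs @ p # ps)"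
  proof -
    have sh: "shuffle ((v, h) # xs) (xs @ [(v, h)])" if sub: "set xs \<subseteq> set zs \<union> set ps" for xs
    proof (rule shuffle_past)
      fix r assume "r \<in> set xs"
      then consider "r \<in> set zs" | "r \<in> set ps" using sub by blast
      then have "adj (fst p) (fst r)"
        using Cons.prems(2) Cons.prems(3)[of p r] by cases simp_all
      then show "adj (fst r) (fst (v, h))" by (simp add: p adj_sym)
    qed
    have "shuffle (zs @ q # ps @ ?h) (zs @ q # (v, h) # ps)"
      using shuffle_context[OF shuffle_sym[OF sh[of ps]], of "zs @ [q]" "[]"] by simp
    then have "elt (zs @ q # ps @ ?h) = elt (zs @ [q, (v, h)] @ ps)"
      using elt_shuffle w by simp
    also have "\<dots> = elt (zs @ [(v, h), p] @ ps)"
    proof (rule elt_context)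
      have "(h \<otimes>\<^bsub>G v\<^esub> g \<otimes>\<^bsub>G v\<^esub> inv\<^bsub>G v\<^esub> h) \<otimes>\<^bsub>G v\<^esub> h = h \<otimes>\<^bsub>G v\<^esub> g"
        using h p by (simp add: Gv.m_assoc)
      then show "elt [q, (v, h)] = elt [(v, h), p]"
        using h p q by (simp add: elt_merge)
    qed (use w in simp_all)
    also have "\<dots> = elt ((v, h) # zs @ p # ps)"
    proof (rule elt_shuffle)
      show "shuffle (zs @ [(v, h), p] @ ps) ((v, h) # zs @ p # ps)"
        using shuffle_context[OF shuffle_sym[OF sh[of zs]], of "[]" "p # ps"] by simp
    qed (use w in simp)
    finally show ?thesis
      using w elt_append[of "zs @ q # ps" ?h] elt_append[of ?h "zs @ p # ps"] by simp
  qed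
  then have "elt (zs @ q # ps) = elt ?h \<otimes>\<^bsub>H\<^esub> elt (zs @ p # ps) \<otimes>\<^bsub>H\<^esub> inv\<^bsub>H\<^esub> elt ?h"
    using w H.inv_solve_right[of "elt (zs @ q # ps)" "elt ?h \<otimes>\<^bsub>H\<^esub> elt (zs @ p # ps)" "elt ?h"]
    by simp
  then have "conjugate_in H (elt (zs @ p # ps)) (elt (zs @ q # ps))"
    unfolding conjugate_in_def using w by (intro bexI[of _ "elt ?h"]) simp_all
  moreover have "conjugate_in H (elt ((zs @ [q]) @ ps)) (elt ((zs @ [q]) @ qs))"
    using Cons.prems w q' by (intro Cons.IH) (auto simp: adj_sym)
  ultimately show ?case
    using conjugate_in_trans[OF H.group_axioms] w by simp
qed

text \<open>
  The identity is excluded because the empty word, which represents it here, is not graphically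
  reduced.
\<close>

lemma conjugate_decomposition:
  assumes "a \<noteq> \<one>\<^bsub>H\<^esub>" "graphically_cyclically_reduced V E G a" "graphically_cyclically_reduced V E G b"
    "conjugate_in H a b"
  shows "\<exists>xs ys ps qs.
      length xs = length ys \<and> length ps = length qs \<and>
      graphically_reduced V E G (xs @ ps) \<and> graphically_reduced V E G (ys @ qs) \<and>
      a = elt (xs @ ps) \<and> b = elt (ys @ qs) \<and>
      (\<forall>i<length ps.
        floating E (xs @ ps) (length xs + i) \<and> floating E (ys @ qs) (length ys + i) \<and>
        fst (ps ! i) = fst (qs ! i) \<and>
        conjugate_in (G (fst (ps ! i))) (snd (ps ! i)) (snd (qs ! i))) \<and>
      (word_move E)\<^sup>*\<^sup>* xs ys"
proof -
  have carr: "a \<in> carrier H" "b \<in> carrier H"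
    using assms by (simp_all add: graphically_cyclically_reduced_def)
  obtain h where h: "h \<in> carrier H" "b = h \<otimes>\<^bsub>H\<^esub> a \<otimes>\<^bsub>H\<^esub> inv\<^bsub>H\<^esub> h"
    using assms(4) unfolding conjugate_in_def by blast
  then have ha: "h \<otimes>\<^bsub>H\<^esub> a = b \<otimes>\<^bsub>H\<^esub> h" using carr by (simp add: H.m_assoc)
  obtain wa where wa: "wa \<in> words" "reduced wa" "elt wa = a" by (rule reduced_word_exists[OF carr(1)])
  obtain wb where wb: "wb \<in> words" "reduced wb" "elt wb = b" by (rule reduced_word_exists[OF carr(2)])
  obtain g where g: "g \<in> words" "reduced g" "elt g = h" by (rule reduced_word_exists[OF h(1)])
  have ne: "wa \<noteq> []" "wb \<noteq> []"
  proof -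
    show "wa \<noteq> []" using wa assms(1) by auto
    show "wb \<noteq> []"
    proof
      assume "wb = []"
      then have "b = \<one>\<^bsub>H\<^esub>" unfolding wb(3)[symmetric] by simp
      then have "inv\<^bsub>H\<^esub> h \<otimes>\<^bsub>H\<^esub> \<one>\<^bsub>H\<^esub> \<otimes>\<^bsub>H\<^esub> h = a"
        using H.inv_conj_cancel[OF h(1) carr(1)] unfolding h(2) by simp
      then show False using assms(1) h(1) by simp
    qed
  qed
  have cyc: "cyclically_reduced wa" "cyclically_reduced wb"
    using assms(2,3) wa wb ne
    unfolding graphically_cyclically_reduced_def graphically_reduced_iff
    by (blast intro: cyclically_reduced_if_graphically)+
  have moves: "conj_move\<^sup>*\<^sup>* wa wb"
    using g wa wb cyc ha by (intro conj_moves_if_conjugate[of g]) (simp_all add: elt_append)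
  define P where "P = (\<lambda>s :: 'v \<times> 'g. isolated (vertices wa) (fst s))"
  let ?xs = "filter (\<lambda>s. \<not> P s) wa" and ?ps = "filter P wa" and ?ys = "filter (\<lambda>s. \<not> P s) wb"
  obtain qs where vert: "vertices wb = vertices wa" and wm: "(word_move E)\<^sup>*\<^sup>* ?xs ?ys"
    and qs: "mset qs = mset (filter P wb)" "pairwise_conjugate ?ps qs"
    using conj_moves_nonfloating[OF moves wa(1)] unfolding P_def by blast
  have sa: "shuffle wa (?xs @ ?ps)"
    using shuffle_isolated_last[of ?ps wa] by (simp add: P_def)
  have sb: "shuffle wb (?ys @ qs)"
    using shuffle_isolated_last[of qs wb] qs(1) vert by (simp add: P_def)
  have len: "length ?ps = length qs" using qs(2) by (rule list_all2_lengthD)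
  have "length wa = length wb" using vert by (metis length_map size_mset)
  then have lxy: "length ?xs = length ?ys"
    using len shuffle_length[OF sa] shuffle_length[OF sb] by simp
  have gr: "graphically_reduced V E G w'"
    if "w \<in> words" "reduced w" "w \<noteq> []" "shuffle w w'" for w w'
    using that shuffle_words[OF that(4)] reduced_shuffle[OF that(4)] shuffle_length[OF that(4)]
    by (auto simp: graphically_reduced_iff)
  have vx: "vertices (?xs @ ?ps) = vertices wa" "vertices (?ys @ qs) = vertices wa"
    unfolding mset_map shuffle_mset[OF sa, symmetric] shuffle_mset[OF sb, symmetric]
    using vert by simp_all
  have "floating E (?xs @ ?ps) (length ?xs + i) \<and> floating E (?ys @ qs) (length ?ys + i) \<and>
      fst (?ps ! i) = fst (qs ! i) \<and> conjugate_in (G (fst (?ps ! i))) (snd (?ps ! i)) (snd (qs ! i))"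
    if i: "i < length ?ps" for i
  proof -
    have pq: "fst (?ps ! i) = fst (qs ! i)"
      "conjugate_in (G (fst (?ps ! i))) (snd (?ps ! i)) (snd (qs ! i))"
      using list_all2_nthD[OF qs(2) i] by blast+
    have "P (?ps ! i)" using nth_mem[OF i] by simp
    then have iso: "isolated (vertices wa) (fst (?ps ! i))" by (simp add: P_def)
    have "floating E (?xs @ ?ps) (length ?xs + i)"
    proof (rule floating_if_isolated)
      show "isolated (vertices (?xs @ ?ps)) (fst ((?xs @ ?ps) ! (length ?xs + i)))"
        unfolding vx using iso by (simp add: nth_append)
    qed (use i in simp)
    moreover have "floating E (?ys @ qs) (length ?ys + i)"
    proof (rule floating_if_isolated)
      show "isolated (vertices (?ys @ qs)) (fst ((?ys @ qs) ! (length ?ys + i)))"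
        unfolding vx using iso pq by (simp add: nth_append)
    qed (use i len in simp)
    ultimately show ?thesis using pq by blast
  qed
  moreover have "graphically_reduced V E G (?xs @ ?ps)" using gr[OF wa(1,2) ne(1) sa] .
  moreover have "graphically_reduced V E G (?ys @ qs)" using gr[OF wb(1,2) ne(2) sb] .
  moreover have "a = elt (?xs @ ?ps)" using elt_shuffle[OF sa wa(1)] wa(3) by simp
  moreover have "b = elt (?ys @ qs)" using elt_shuffle[OF sb wb(1)] wb(3) by simp
  ultimately show ?thesis using lxy len wm by blast
qed

lemma conjugate_if_decomposition:
  assumes "length ps = length qs" "xs @ ps \<in> words"
    "\<forall>i<length ps. floating E (xs @ ps) (length xs + i) \<and> fst (ps ! i) = fst (qs ! i) \<and>
      conjugate_in (G (fst (ps ! i))) (snd (ps ! i)) (snd (qs ! i))"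
    "(word_move E)\<^sup>*\<^sup>* xs ys"
  shows "conjugate_in H (elt (xs @ ps)) (elt (ys @ qs))"
proof -
  have flt: "adj (fst (ps ! i)) (fst ((xs @ ps) ! k))"
    if "i < length ps" "k < length (xs @ ps)" "k \<noteq> length xs + i" for i k
  proof -
    have "floating E (xs @ ps) (length xs + i)" using assms(3) that(1) by blast
    then have "adj (fst ((xs @ ps) ! (length xs + i))) (fst ((xs @ ps) ! k))"
      using that(2,3) unfolding floating_def by blast
    then show ?thesis by simp
  qed
  have px: "adj (fst p) (fst x)" if p: "p \<in> set ps" and x: "x \<in> set xs" for p x
  proof -
    obtain i where i: "i < length ps" "p = ps ! i"
      using p by (auto simp: in_set_conv_nth)
    obtain k where "k < length xs" "x = xs ! k"
      using x by (auto simp: in_set_conv_nth)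
    with i show ?thesis using flt[of i k] by (simp add: nth_append)
  qed
  have sorted: "sorted_wrt (\<lambda>p q. adj (fst p) (fst q)) ps"
    unfolding sorted_wrt_iff_nth_less
  proof (intro allI impI)
    fix i j assume "i < j" "j < length ps"
    then show "adj (fst (ps ! i)) (fst (ps ! j))"
      using flt[of i "length xs + j"] by (simp add: nth_append)
  qed
  have pc: "pairwise_conjugate ps qs"
    unfolding list_all2_conv_all_nth using assms(1,3) by blast
  have step: "mset ys = mset xs" "conjugate_in H (elt (xs @ ps)) (elt (ys @ ps))"
    using word_moves_conjugate[OF assms(4,2)] px by auto
  have set_ys: "set ys = set xs" using step(1) by (rule mset_eq_setD)
  then have "ys @ ps \<in> words" using assms(2) by (simp add: in_lists_conv_set)
  moreover have "adj (fst p) (fst y)" if "p \<in> set ps" "y \<in> set ys" for p y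
    using px that set_ys by simp
  ultimately have "conjugate_in H (elt (ys @ ps)) (elt (ys @ qs))"
    using pc sorted by (intro pairwise_conjugate_elt)
  then show ?thesis using step(2) conjugate_in_trans[OF H.group_axioms] assms(2) by simp
qed

end

theorem theorem1p4:
  fixes V :: "'v set" and E :: "'v set set"
    and G :: "'v \<Rightarrow> ('g, 'm) monoid_scheme"
    and a b :: "('v \<times> 'g) list set set"
  assumes "V \<noteq> {}" and "simplicial_graph V E"
    and "\<And>v. v \<in> V \<Longrightarrow> group (G v)"
    and "\<And>v. v \<in> V \<Longrightarrow> carrier (G v) \<noteq> {\<one>\<^bsub>G v\<^esub>}"
    and "graphically_cyclically_reduced V E G a"
    and "graphically_cyclically_reduced V E G b"
  shows "conjugate_in (graph_product V E G) a b \<longleftrightarrow>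
    (\<exists>xs ys ps qs.
      length xs = length ys \<and> length ps = length qs \<and>
      graphically_reduced V E G (xs @ ps) \<and> graphically_reduced V E G (ys @ qs) \<and>
      a = word_elem V E G (xs @ ps) \<and> b = word_elem V E G (ys @ qs) \<and>
      (\<forall>i<length ps.
        floating E (xs @ ps) (length xs + i) \<and> floating E (ys @ qs) (length ys + i) \<and>
        fst (ps ! i) = fst (qs ! i) \<and>
        conjugate_in (G (fst (ps ! i))) (snd (ps ! i)) (snd (qs ! i))) \<and>
      (word_move E)\<^sup>*\<^sup>* xs ys)"
    (is "?L \<longleftrightarrow> ?R")
proof -
  interpret graph_product_data V E G
    using assms(2,3) by (rule graph_product_data.intro)
  show ?thesis
  proof
    assume conj: ?L
    show ?R
    proof (cases "a = \<one>\<^bsub>graph_product V E G\<^esub>")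
      case False
      then show ?thesis using assms(5,6) conj by (rule conjugate_decomposition)
    next
      case True
      \<comment> \<open>A conjugate of the identity is the identity, which is represented by a trivial syllable.\<close>
      obtain v where v: "v \<in> V" using assms(1) by blast
      interpret Gv: group "G v" using assms(3) v .
      let ?w = "[(v, \<one>\<^bsub>G v\<^esub>)]"
      have "a = word_elem V E G ?w" using True elt_one[OF v] by simp
      moreover have "b = word_elem V E G ?w"
        using conj True elt_one[OF v] by (auto simp: conjugate_in_def)
      moreover have "graphically_reduced V E G ?w"
        using v by (simp add: graphically_reduced_iff syllables_def)
      ultimately show ?thesis
        by (intro exI[of _ ?w] exI[of _ "[]"]) simp
    qed
  next
    assume ?R
    then obtain xs ys ps qs where len: "length ps = length qs"
      and red: "graphically_reduced V E G (xs @ ps)"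
      and ab: "a = word_elem V E G (xs @ ps)" "b = word_elem V E G (ys @ qs)"
      and fl: "\<forall>i<length ps.
        floating E (xs @ ps) (length xs + i) \<and> floating E (ys @ qs) (length ys + i) \<and>
        fst (ps ! i) = fst (qs ! i) \<and>
        conjugate_in (G (fst (ps ! i))) (snd (ps ! i)) (snd (qs ! i))"
      and moves: "(word_move E)\<^sup>*\<^sup>* xs ys"
      by blast
    have "xs @ ps \<in> lists (syllables V G)" using red unfolding graphically_reduced_def by blast
    then show ?L unfolding ab using len fl moves by (intro conjugate_if_decomposition) blast+
  qed
qed

end
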